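(* Fix $p,q\in\mathbb{N}$ and let $\mu=(p^q)$ be the rectangular partition with $q$ rows of length $p$. Consider the problem whose instances are pairs $(\lambda,N)$, where $N\ge|\lambda|$ is a positive integer and $\lambda$ is a partition such that $\lambda\subseteq\mu\cup\lambda^{\circ}$ for some partition $\lambda^{\circ}$ of rank two, and in which the quantity to be computed is $f^{\lambda,N}$. There is a fully polynomial randomized approximation scheme (FPRAS) for $f^{\lambda,N}$ on these instances.
   Context: A partition is a finite weakly decreasing sequence of positive integers $\lambda=(\lambda_1\ge\cdots\ge\lambda_\ell>0)$, identified with its Young diagram $\{(r,c): 1\le r\le \ell,\ 1\le c\le\lambda_r\}$ (left-justified boxes, rows numbered from the top, columns from the left). $|\lambda|$ is the number of boxes. Containment and unions of partitions are those of their Young diagrams. The rank of a partition is the length of the main diagonal of its Young diagram, i.e. the number of boxes of the form $(i,i)$. For $N\ge|\lambda|$, an $N$-standard set-valued tableau of shape $\lambda$ is an assignment of a nonempty subset of $\{1,\ldots,N\}$ to each box of $\lambda$ such that each value in $\{1,\ldots,N\}$ appears exactly once overall and, whenever a single value is selected from each box, the resulting filling increases down each column and weakly increases from left to right along each row. Let $\mathsf{SVT}(\lambda,N)$ be the set of these, and $f^{\lambda,N}=|\mathsf{SVT}(\lambda,N)|$. A FPRAS for $f^{\lambda,N}$ is a randomized algorithm that, given an instance $(\lambda,N)$ and any $\epsilon,\delta\in(0,1]$, computes an approximation $A$ such that $P\big((1-\epsilon)f^{\lambda,N}\le A\le(1+\epsilon)f^{\lambda,N}\big)\ge 1-\delta$,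 in time polynomial in $|\lambda|$, $N$, $\frac1\epsilon$ and $\ln\delta^{-1}$. *)

theory Defs
  imports "HOL-Library.FuncSet" "HOL-Library.Stream"
    "HOL-Probability.Probability_Mass_Function"
begin

section \<open>Partitions and set-valued tableaux\<close>

definition is_partition :: "nat list \<Rightarrow> bool" where
  "is_partition l \<longleftrightarrow> sorted_wrt (\<ge>) l \<and> 0 \<notin> set l"

text \<open>Boxes \<open>(r, c)\<close> are indexed from 1, whereas list positions are indexed from 0.\<close>

definition diagram :: "nat list \<Rightarrow> (nat \<times> nat) set" where
  "diagram l = {(r, c). 1 \<le> r \<and> r \<le> length l \<and> 1 \<le> c \<and> c \<le> l ! (r - 1)}"

definition boxes :: "nat list \<Rightarrow> nat" where
  "boxes l = card (diagram l)"

definition rank :: "nat list \<Rightarrow> nat" where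
  "rank l = card {i. (i, i) \<in> diagram l}"

definition semistandard :: "nat list \<Rightarrow> (nat \<times> nat \<Rightarrow> nat) \<Rightarrow> bool" where
  "semistandard l t \<longleftrightarrow>
     (\<forall>r r' c. (r, c) \<in> diagram l \<and> (r', c) \<in> diagram l \<and> r < r' \<longrightarrow> t (r, c) < t (r', c)) \<and>
     (\<forall>r c c'. (r, c) \<in> diagram l \<and> (r, c') \<in> diagram l \<and> c < c' \<longrightarrow> t (r, c) \<le> t (r, c'))"

text \<open>Tableaux are extensional functions on the diagram, so that distinct elements of \<open>SVT l N\<close>
  are distinct tableaux.\<close>

definition SVT :: "nat list \<Rightarrow> nat \<Rightarrow> (nat \<times> nat \<Rightarrow> nat set) set" where
  "SVT l N =
     {T \<in> diagram l \<rightarrow>\<^sub>E Pow {1..N} - {{}}.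
        (\<forall>v\<in>{1..N}. \<exists>!b. b \<in> diagram l \<and> v \<in> T b) \<and>
        (\<forall>t \<in> Pi (diagram l) T. semistandard l t)}"

definition svt_count :: "nat list \<Rightarrow> nat \<Rightarrow> nat" where
  "svt_count l N = card (SVT l N)"

section \<open>Randomized random access machines\<close>

text \<open>
  Randomized algorithms are structured programs for a random access machine with coin flips.
  The machine has registers, named by constants in the program, and an unbounded memory
  that is addressed indirectly through registers; both hold natural numbers of unbounded size.
  Every instruction has unit cost. As addition and truncated subtraction are the only arithmetic
  operations, the bit length of the numbers grows by at most one per step, hence
  polynomial time on this machine is the same as polynomial time on a probabilistic
  Turing machine (Cook and Reckhow).

  Accuracy parameters \<open>\<epsilon>\<close> and \<open>\<delta>\<close> are arbitrary reals and are supplied as infinite sequences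
  of binary digits that the program can read one after the other, at unit cost per digit.
\<close>

datatype com =
    Skip
  | Const nat nat
  | Add nat nat nat
  | Sub nat nat nat
  | Load nat nat
  | Store nat nat
  | Flip nat
  | Read_eps nat
  | Read_delta nat
  | Seq com com
  | Cond nat com com
  | While nat com

record state =
  reg :: "nat \<Rightarrow> nat"
  mem :: "nat \<Rightarrow> nat"
  eps_digits :: "nat stream"
  delta_digits :: "nat stream"

definition set_reg :: "nat \<Rightarrow> nat \<Rightarrow> state \<Rightarrow> state" where
  "set_reg r v s = s\<lparr>reg := (reg s)(r := v)\<rparr>"

type_synonym config = "com \<times> state"

text \<open>A configuration consists of the program that remains to be executed and the current state.
  \<open>Skip\<close> is the halted program. \<open>Cond\<close> and \<open>While\<close> test whether a register is nonzero.\<close>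

fun step :: "com \<Rightarrow> state \<Rightarrow> config pmf" where
  "step Skip s = return_pmf (Skip, s)"
| "step (Const r k) s = return_pmf (Skip, set_reg r k s)"
| "step (Add r a b) s = return_pmf (Skip, set_reg r (reg s a + reg s b) s)"
| "step (Sub r a b) s = return_pmf (Skip, set_reg r (reg s a - reg s b) s)"
| "step (Load r a) s = return_pmf (Skip, set_reg r (mem s (reg s a)) s)"
| "step (Store a r) s = return_pmf (Skip, s\<lparr>mem := (mem s)(reg s a := reg s r)\<rparr>)"
| "step (Flip r) s =
     map_pmf (\<lambda>b. (Skip, set_reg r (of_bool b) s)) (bernoulli_pmf (1 / 2))"
| "step (Read_eps r) s =
     return_pmf (Skip, set_reg r (shd (eps_digits s)) (s\<lparr>eps_digits := stl (eps_digits s)\<rparr>))"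
| "step (Read_delta r) s =
     return_pmf (Skip, set_reg r (shd (delta_digits s)) (s\<lparr>delta_digits := stl (delta_digits s)\<rparr>))"
| "step (Seq P Q) s =
     (if P = Skip then return_pmf (Q, s)
      else map_pmf (\<lambda>(P', s'). (Seq P' Q, s')) (step P s))"
| "step (Cond r P Q) s = return_pmf (if reg s r \<noteq> 0 then P else Q, s)"
| "step (While r P) s = return_pmf (if reg s r \<noteq> 0 then Seq P (While r P) else Skip, s)"

fun run :: "nat \<Rightarrow> config \<Rightarrow> config pmf" where
  "run 0 cfg = return_pmf cfg"
| "run (Suc t) cfg = bind_pmf (case cfg of (P, s) \<Rightarrow> step P s) (run t)"

definition halted :: "config \<Rightarrow> bool" where
  "halted cfg \<longleftrightarrow> fst cfg = Skip"

section \<open>Fully polynomial randomized approximation schemes\<close>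

text \<open>The first digit is the integer part, which is nonzero only for \<open>x = 1\<close> if \<open>x \<in> (0, 1]\<close>;
  the following ones are the digits after the binary point.\<close>

definition binary_digits :: "real \<Rightarrow> nat stream" where
  "binary_digits x = smap (\<lambda>k. nat \<lfloor>x * 2 ^ k\<rfloor> mod 2) nats"

text \<open>Register 0 initially holds \<open>N\<close>, register 1 the number of parts of the partition \<open>l\<close>,
  and the parts are in the memory cells from address 0 on.\<close>

definition init :: "nat list \<Rightarrow> nat \<Rightarrow> real \<Rightarrow> real \<Rightarrow> state" where
  "init l N \<epsilon> \<delta> =
     \<lparr>reg = (\<lambda>_. 0)(0 := N, 1 := length l),
      mem = (\<lambda>a. if a < length l then l ! a else 0),
      eps_digits = binary_digits \<epsilon>,
      delta_digits = binary_digits \<delta>\<rparr>"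

text \<open>The result is the rational number with numerator in register 0 and positive denominator
  in register 1.\<close>

definition outputs :: "config \<Rightarrow> real \<Rightarrow> bool" where
  "outputs cfg A \<longleftrightarrow> halted cfg \<and> reg (snd cfg) 1 > 0 \<and>
     A = real (reg (snd cfg) 0) / real (reg (snd cfg) 1)"

definition poly4 ::
  "nat \<Rightarrow> (nat \<Rightarrow> nat \<Rightarrow> nat \<Rightarrow> nat \<Rightarrow> real) \<Rightarrow> real \<Rightarrow> real \<Rightarrow> real \<Rightarrow> real \<Rightarrow> real" where
  "poly4 d c w x y z =
     (\<Sum>i\<le>d. \<Sum>j\<le>d. \<Sum>k\<le>d. \<Sum>m\<le>d. c i j k m * w ^ i * x ^ j * y ^ k * z ^ m)"

text \<open>The time bound applies to every run of the program, whatever the coin flips are.\<close>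

definition is_fpras :: "com \<Rightarrow> (nat list \<times> nat) set \<Rightarrow> (nat list \<Rightarrow> nat \<Rightarrow> nat) \<Rightarrow> bool" where
  "is_fpras P I f \<longleftrightarrow>
     (\<exists>d c. \<forall>(l, N)\<in>I. \<forall>\<epsilon>\<in>{0<..1}. \<forall>\<delta>\<in>{0<..1}.
        \<exists>t. real t \<le> poly4 d c (real (boxes l)) (real N) (1 / \<epsilon>) (ln (1 / \<delta>)) \<and>
            (\<forall>cfg \<in> set_pmf (run t (P, init l N \<epsilon> \<delta>)). halted cfg) \<and>
            measure_pmf.prob (run t (P, init l N \<epsilon> \<delta>))
              {cfg. \<exists>A. outputs cfg A \<and>
                 (1 - \<epsilon>) * real (f l N) \<le> A \<and> A \<le> (1 + \<epsilon>) * real (f l N)} \<ge> 1 - \<delta>)"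

text \<open>The instances for the rectangular partition with \<open>q\<close> rows of length \<open>p\<close>.\<close>

definition instances :: "nat \<Rightarrow> nat \<Rightarrow> (nat list \<times> nat) set" where
  "instances p q =
     {(l, N). is_partition l \<and> N > 0 \<and> N \<ge> boxes l \<and>
        (\<exists>l0. is_partition l0 \<and> rank l0 = 2 \<and>
           diagram l \<subseteq> diagram (replicate q p) \<union> diagram l0)}"

end

theory Submission
  imports Defs
begin

text \<open>
  A set-valued tableau is built by inserting the values \<open>1, \<dots>, N\<close> one after the other. Each value
  either starts a new box or joins a box of the current shape, which in both cases is a removable
  corner of the shape afterwards. Hence \<open>f(\<lambda>, n + 1)\<close> is the sum of \<open>f(\<lambda>, n) + f(\<lambda> - b, n)\<close> over the
  corners \<open>b\<close> of \<open>\<lambda>\<close>. As \<open>\<lambda>\<close> has at most two columns below row \<open>Q = q + 2\<close>, its subpartitions are described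
  by \<open>Q + 2\<close> coordinates that are at most \<open>N\<close>, so that dynamic programming over the polynomially
  many subpartitions computes \<open>f(\<lambda>, N)\<close> exactly and without any randomness.\<close>

section \<open>Tableaux as words\<close>

text \<open>The machine shapes the second half of the proof: it has one linear memory and can only
  add and subtract. A shape together with a word length is therefore packed into one address in base
  \<open>N + 1\<close>. Removing a corner then means subtracting a power of the base without a
  borrow, and passing to shorter words means subtracting one layer size. The recurrence thus refers
  to smaller addresses only, and one upward sweep through memory evaluates it. Digits are unpacked
  by repeated subtraction, in time linear in the address; this remains polynomial in
  \<open>N\<close> because the number \<open>Q + 2\<close> of coordinates is a constant of the
  program. The sweep covers all coordinate vectors, not only the subpartitions of the input, so it
  needs no test for containment or validity: a valid shape minus a corner is again valid, hence a
  valid cell never reads an invalid one.\<close>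

definition below :: "nat \<times> nat \<Rightarrow> nat \<times> nat \<Rightarrow> bool" where
  "below a b \<longleftrightarrow> snd a = snd b \<and> fst a < fst b \<or> fst a = fst b \<and> snd a < snd b"

text \<open>The letter at position \<open>v - 1\<close> is the box that holds the value
  \<open>v\<close>. Distinct boxes never share a value, so weak increase along rows amounts to
  strict increase and one relation \<open>below\<close> serves rows and columns alike.\<close>

definition words :: "(nat \<times> nat) set \<Rightarrow> nat \<Rightarrow> (nat \<times> nat) list set" where
  "words D n = {xs. length xs = n \<and> set xs = D \<and> sorted_wrt (\<lambda>a b. \<not> below b a) xs}"

text \<open>For a Young diagram these are the removable corners.\<close>

definition maximal :: "(nat \<times> nat) set \<Rightarrow> (nat \<times> nat) set" where
  "maximal D = {b \<in> D. \<forall>a\<in>D. \<not> below b a}"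

lemma below_irrefl [simp]: "\<not> below a a"
  by (simp add: below_def)

lemma finite_words: "finite D \<Longrightarrow> finite (words D n)"
  by (rule finite_subset[OF _ finite_lists_length_eq[of D n]]) (auto simp: words_def)

lemma card_words_0: "card (words D 0) = (if D = {} then 1 else 0)"
proof -
  have "words D 0 = (if D = {} then {[]} else {})"
    by (auto simp: words_def)
  then show ?thesis by simp
qed

text \<open>The last letter \<open>b\<close> cannot precede any other box of \<open>D\<close>.
  Without it, the letter set is still \<open>D\<close> if \<open>b\<close> occurred before, and
  \<open>D - {b}\<close> otherwise.\<close>

lemma words_Suc:
  "words D (Suc n) = (\<Union>b\<in>maximal D. (\<lambda>xs. xs @ [b]) ` (words D n \<union> words (D - {b}) n))"
  (is "?L = ?R")
proof (intro equalityI subsetI)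
  fix ys assume ys: "ys \<in> ?L"
  then obtain xs b where eq: "ys = xs @ [b]"
    by (cases ys rule: rev_cases) (auto simp: words_def)
  have "b \<in> maximal D"
    using ys by (auto simp: eq words_def maximal_def sorted_wrt_append)
  moreover have "xs \<in> words D n \<union> words (D - {b}) n"
    using ys by (auto simp: eq words_def sorted_wrt_append)
  ultimately show "ys \<in> ?R" by (auto simp: eq)
next
  fix ys assume "ys \<in> ?R"
  then show "ys \<in> ?L"
    by (auto simp: words_def maximal_def sorted_wrt_append)
qed

lemma card_words_Suc:
  assumes "finite D"
  shows "card (words D (Suc n)) =
    (\<Sum>b\<in>maximal D. card (words D n) + card (words (D - {b}) n))"
proof -
  have "card (words D (Suc n)) =
      (\<Sum>b\<in>maximal D. card ((\<lambda>xs. xs @ [b]) ` (words D n \<union> words (D - {b}) n)))"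
    unfolding words_Suc
    using assms by (intro card_UN_disjoint) (auto simp: finite_words maximal_def)
  also have "\<dots> = (\<Sum>b\<in>maximal D. card (words D n) + card (words (D - {b}) n))"
  proof (rule sum.cong[OF refl])
    fix b assume "b \<in> maximal D"
    then have "words D n \<inter> words (D - {b}) n = {}"
      by (auto simp: words_def maximal_def)
    then show "card ((\<lambda>xs. xs @ [b]) ` (words D n \<union> words (D - {b}) n)) =
        card (words D n) + card (words (D - {b}) n)"
      using assms by (subst card_image) (auto simp: inj_on_def card_Un_disjoint finite_words)
  qed
  finally show ?thesis .
qed

section \<open>Bijection between words and set-valued tableaux\<close>

definition tableau :: "(nat \<times> nat) set \<Rightarrow> nat \<Rightarrow> (nat \<times> nat) list \<Rightarrow> nat \<times> nat \<Rightarrow> nat set" where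
  "tableau D N xs = (\<lambda>b\<in>D. {v \<in> {1..N}. xs ! (v - 1) = b})"

lemma below_values:
  assumes xs: "xs \<in> words D N" and "below a b" and "a \<in> D" "b \<in> D"
    and "v \<in> tableau D N xs a" "w \<in> tableau D N xs b"
  shows "v < w"
proof (rule ccontr)
  assume "\<not> v < w"
  moreover have "v \<noteq> w" using assms by (auto simp: tableau_def)
  ultimately have "w - 1 < v - 1" "v - 1 < length xs"
    using assms by (auto simp: tableau_def words_def)
  then have "\<not> below (xs ! (v - 1)) (xs ! (w - 1))"
    using xs by (auto simp: words_def dest: sorted_wrt_nth_less)
  then show False using assms by (auto simp: tableau_def)
qed

lemma tableau_in_SVT:
  assumes xs: "xs \<in> words (diagram l) N"
  shows "tableau (diagram l) N xs \<in> SVT l N"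
proof -
  let ?D = "diagram l" and ?T = "tableau (diagram l) N xs"
  have len: "length xs = N" and set: "set xs = ?D" using xs by (auto simp: words_def)
  have "?T b \<noteq> {}" if "b \<in> ?D" for b
  proof -
    have "b \<in> set xs" using that set by simp
    then obtain i where i: "i < N" "xs ! i = b"
      using len by (auto simp: in_set_conv_nth)
    then have "Suc i \<in> ?T b" using that by (auto simp: tableau_def)
    then show ?thesis by blast
  qed
  then have "?T \<in> ?D \<rightarrow>\<^sub>E Pow {1..N} - {{}}"
    by (auto simp: tableau_def)
  moreover have "\<exists>!b. b \<in> ?D \<and> v \<in> ?T b" if "v \<in> {1..N}" for v
  proof
    have "v - 1 < length xs" using that len by auto
    then have "xs ! (v - 1) \<in> ?D" using set nth_mem by blast
    then show "xs ! (v - 1) \<in> ?D \<and> v \<in> ?T (xs ! (v - 1))"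
      using that by (auto simp: tableau_def)
  next
    fix b assume "b \<in> ?D \<and> v \<in> ?T b"
    then show "b = xs ! (v - 1)" by (auto simp: tableau_def)
  qed
  moreover have "semistandard l t" if t: "t \<in> Pi ?D ?T" for t
  proof -
    have "t a < t b" if "a \<in> ?D" "b \<in> ?D" "below a b" for a b
      using below_values[OF xs that(3,1,2)] t that by auto
    then show ?thesis
      unfolding semistandard_def by (auto simp: below_def less_imp_le)
  qed
  ultimately show ?thesis by (auto simp: SVT_def)
qed

lemma inj_on_tableau: "inj_on (tableau D N) (words D N)"
proof (rule inj_onI)
  fix xs ys assume xs: "xs \<in> words D N" and ys: "ys \<in> words D N"
    and eq: "tableau D N xs = tableau D N ys"
  show "xs = ys"
  proof (rule nth_equalityI)
    show "length xs = length ys" using xs ys by (simp add: words_def)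
    fix i assume i: "i < length xs"
    then have D: "xs ! i \<in> D" using xs by (auto simp: words_def)
    then have "Suc i \<in> tableau D N xs (xs ! i)"
      using i xs by (auto simp: tableau_def words_def)
    then have "Suc i \<in> tableau D N ys (xs ! i)" by (simp add: eq)
    then show "xs ! i = ys ! i" using D by (auto simp: tableau_def)
  qed
qed

text \<open>The word lists, for each value, the unique box that contains it; its order condition
  comes from testing the tableau on suitable selections.\<close>

lemma SVT_is_tableau:
  assumes T: "T \<in> SVT l N"
  shows "T \<in> tableau (diagram l) N ` words (diagram l) N"
proof -
  let ?D = "diagram l"
  define box where "box v = (THE b. b \<in> ?D \<and> v \<in> T b)" for v
  define xs where "xs = map (\<lambda>i. box (Suc i)) [0..<N]"
  have ne: "T b \<noteq> {}" and sub: "T b \<subseteq> {1..N}" if "b \<in> ?D" for b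
    using T that by (auto simp: SVT_def)
  have ex1: "\<exists>!b. b \<in> ?D \<and> v \<in> T b" if "v \<in> {1..N}" for v
    using T that by (auto simp: SVT_def)
  have box: "box v \<in> ?D \<and> v \<in> T (box v)" if "v \<in> {1..N}" for v
    unfolding box_def by (rule theI'[OF ex1[OF that]])
  have box_eq: "box v = b" if "v \<in> {1..N}" "b \<in> ?D" "v \<in> T b" for v b
    using ex1[OF that(1)] box[OF that(1)] that by blast
  have "set xs = ?D"
  proof
    show "set xs \<subseteq> ?D" using box by (auto simp: xs_def)
    show "?D \<subseteq> set xs"
    proof
      fix b assume b: "b \<in> ?D"
      then obtain v where v: "v \<in> T b" using ne by blast
      then have v1: "v \<in> {1..N}" using sub b by blast
      then have "xs ! (v - 1) = b" "v - 1 < length xs"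
        using box_eq[OF v1 b v] by (auto simp: xs_def)
      then show "b \<in> set xs" by (metis nth_mem)
    qed
  qed
  moreover have "sorted_wrt (\<lambda>a b. \<not> below b a) xs"
    unfolding sorted_wrt_iff_nth_less
  proof (intro allI impI notI)
    fix i j assume ij: "i < j" "j < length xs" and bel: "below (xs ! j) (xs ! i)"
    let ?a = "xs ! i" and ?b = "xs ! j"
    \<comment> \<open>An arbitrary selection, forced to \<open>Suc i\<close> and
      \<open>Suc j\<close> at the two boxes in question: semistandardness would give
      \<open>j \<le> i\<close>.\<close>
    define t where "t = ((\<lambda>x. SOME u. u \<in> T x)(?a := Suc i, ?b := Suc j))"
    have a: "?a \<in> ?D" "Suc i \<in> T ?a" and b: "?b \<in> ?D" "Suc j \<in> T ?b"
      using ij box[of "Suc i"] box[of "Suc j"] by (auto simp: xs_def)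
    have "t \<in> Pi ?D T"
      using a b ne by (auto simp: t_def some_in_eq)
    then have "semistandard l t" using T by (auto simp: SVT_def)
    then have "t ?b \<le> t ?a"
      using bel a b unfolding semistandard_def below_def
      by (metis less_imp_le prod.collapse)
    moreover have "?a \<noteq> ?b" using bel by auto
    ultimately show False using ij by (simp add: t_def)
  qed
  ultimately have "xs \<in> words ?D N" by (simp add: words_def xs_def)
  moreover have "T = tableau ?D N xs"
  proof
    fix b
    show "T b = tableau ?D N xs b"
    proof (cases "b \<in> ?D")
      case True
      have "v \<in> T b \<longleftrightarrow> v \<in> {1..N} \<and> xs ! (v - 1) = b" for v
      proof (cases "v \<in> {1..N}")
        case v: True
        then have "xs ! (v - 1) = box v" by (auto simp: xs_def)
        then show ?thesis using v box[OF v] box_eq[OF v True] by auto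
      next
        case False
        then show ?thesis using sub[OF True] by blast
      qed
      then show ?thesis using True by (auto simp: tableau_def)
    next
      case False
      moreover have "T \<in> ?D \<rightarrow>\<^sub>E Pow {1..N} - {{}}" using T by (simp add: SVT_def)
      ultimately have "T b = undefined" by (rule PiE_arb[rotated])
      then show ?thesis using False by (simp add: tableau_def)
    qed
  qed
  ultimately show ?thesis by blast
qed

lemma svt_count_eq_card_words: "svt_count l N = card (words (diagram l) N)"
proof -
  have "tableau (diagram l) N ` words (diagram l) N = SVT l N"
    using tableau_in_SVT SVT_is_tableau by blast
  then show ?thesis
    unfolding svt_count_def using card_image[OF inj_on_tableau] by metis
qed

section \<open>Coordinates for partitions\<close>

text \<open>If no row below row \<open>Q\<close> is longer than 2, a Young diagram is encoded by \<open>Q + 2\<close> coordinates: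
  \<open>e 0\<close> and \<open>e 1\<close> are the numbers of boxes below row \<open>Q\<close> in columns 2 and 1, and \<open>e i\<close> is the
  length of row \<open>Q + 2 - i\<close> for \<open>i \<ge> 2\<close>. In this order, each coordinate has a lower bound \<open>thr e i\<close>
  depending on the previous ones only (\<open>thr e 2\<close> is the length of row \<open>Q + 1\<close>), and the last box
  counted by \<open>e i\<close> is a removable corner iff the bound is strict.\<close>

definition thr :: "(nat \<Rightarrow> nat) \<Rightarrow> nat \<Rightarrow> nat" where
  "thr e i = (if i = 0 then 0 else if i = 2 then min 1 (e 0) + min 1 (e 1) else e (i - 1))"

definition shape :: "nat \<Rightarrow> (nat \<Rightarrow> nat) \<Rightarrow> (nat \<times> nat) set" where
  "shape Q e = {(r, c). 1 \<le> r \<and> 1 \<le> c \<and>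
     (r \<le> Q \<and> c \<le> e (Q + 2 - r) \<or> Q < r \<and> c = 1 \<and> r \<le> Q + e 1 \<or> Q < r \<and> c = 2 \<and> r \<le> Q + e 0)}"

definition valid :: "nat \<Rightarrow> (nat \<Rightarrow> nat) \<Rightarrow> bool" where
  "valid Q e \<longleftrightarrow> (\<forall>i < Q + 2. thr e i \<le> e i)"

definition top_box :: "nat \<Rightarrow> (nat \<Rightarrow> nat) \<Rightarrow> nat \<Rightarrow> nat \<times> nat" where
  "top_box Q e i = (if i = 0 then (Q + e 0, 2) else if i = 1 then (Q + e 1, 1) else (Q + 2 - i, e i))"

lemma valid_mono:
  assumes "valid Q e" "2 \<le> i" "i \<le> j" "j < Q + 2"
  shows "e i \<le> e j"
  using assms(3,4)
proof (induction j rule: dec_induct)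
  case (step n)
  then have "thr e (Suc n) \<le> e (Suc n)" using assms(1) by (simp add: valid_def)
  then show ?case using step assms(2) by (simp add: thr_def split: if_splits)
qed simp

lemma valid_low:
  assumes "valid Q e"
  shows "e 0 \<le> e 1" "Q > 0 \<Longrightarrow> min 1 (e 0) + min 1 (e 1) \<le> e 2"
proof -
  show "e 0 \<le> e 1" using assms[unfolded valid_def, rule_format, of 1] by (simp add: thr_def)
  show "Q > 0 \<Longrightarrow> min 1 (e 0) + min 1 (e 1) \<le> e 2"
    using assms[unfolded valid_def, rule_format, of 2] by (simp add: thr_def)
qed

text \<open>Lowering a coordinate can only lower the bounds of the others, and its own bound
  involves earlier coordinates only.\<close>

lemma valid_remove:
  assumes "valid Q e" "thr e i < e i"
  shows "valid Q (e(i := e i - 1))"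
  unfolding valid_def
proof (intro allI impI)
  fix j assume j: "j < Q + 2"
  have "thr (e(i := e i - 1)) j \<le> thr e j" by (auto simp: thr_def)
  moreover have "thr e j \<le> e j" using assms(1) j by (simp add: valid_def)
  moreover have "thr e i \<le> e i - 1" using assms(2) by simp
  ultimately show "thr (e(i := e i - 1)) j \<le> (e(i := e i - 1)) j"
    by (cases "j = i") (auto intro: order_trans)
qed

section \<open>Removable corners in coordinates\<close>

lemma finite_shape: "finite (shape Q e)"
proof (rule finite_subset)
  show "shape Q e \<subseteq> {..Q + e 0 + e 1} \<times> ({..2} \<union> (\<Union>r\<in>{1..Q}. {..e (Q + 2 - r)}))"
    by (fastforce simp: shape_def)
qed auto

lemma maximal_shape_subset:
  assumes v: "valid Q e" and Q: "Q > 0"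
  shows "maximal (shape Q e) \<subseteq> top_box Q e ` {i. i < Q + 2 \<and> thr e i < e i}"
proof
  fix b assume "b \<in> maximal (shape Q e)"
  moreover obtain r c where b: "b = (r, c)" by (cases b)
  ultimately have in_shape: "(r, c) \<in> shape Q e"
    and max: "\<And>a. a \<in> shape Q e \<Longrightarrow> \<not> below (r, c) a" by (auto simp: maximal_def)
  have right: "(r, Suc c) \<notin> shape Q e" and down: "(Suc r, c) \<notin> shape Q e"
    using max[of "(r, Suc c)"] max[of "(Suc r, c)"] by (auto simp: below_def)
  note low = valid_low(1)[OF v] valid_low(2)[OF v Q]
  consider "r \<le> Q" | "Q < r" "c = 1" | "Q < r" "c = 2"
    using in_shape by (auto simp: shape_def)
  then have "\<exists>i. b = top_box Q e i \<and> i < Q + 2 \<and> thr e i < e i"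
  proof cases
    case 1
    let ?i = "Q + 2 - r"
    have i: "2 \<le> ?i" "?i < Q + 2" using 1 in_shape by (auto simp: shape_def)
    have c: "c = e ?i" using right in_shape 1 by (auto simp: shape_def)
    \<comment> \<open>Below row \<open>Q\<close> lies the first row of the two-column part, so for
      \<open>r = Q\<close> the bound depends on whether \<open>e 0\<close> and \<open>e 1\<close>
      vanish.\<close>
    have "thr e ?i < c"
    proof (cases "r = Q")
      case True
      then have "\<not> (c = 1 \<and> e 1 \<ge> 1)" "\<not> (c = 2 \<and> e 0 \<ge> 1)" "c \<ge> 1"
        using down in_shape by (auto simp: shape_def)
      then show ?thesis using True low by (auto simp: thr_def)
    next
      case False
      then have "e (?i - 1) < c" using 1 down in_shape by (auto simp: shape_def Suc_diff_le)
      then show ?thesis using False 1 by (auto simp: thr_def)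
    qed
    then show ?thesis
      using c i by (intro exI[of _ ?i]) (auto simp: b top_box_def)
  next
    case 2
    then have "r = Q + e 1" using in_shape down by (auto simp: shape_def)
    moreover have "\<not> r \<le> Q + e 0" using 2 right in_shape by (auto simp: shape_def)
    ultimately show ?thesis
      using 2 by (intro exI[of _ 1]) (auto simp: b top_box_def thr_def)
  next
    case 3
    then have "r = Q + e 0" using in_shape down by (auto simp: shape_def)
    then show ?thesis
      using 3 by (intro exI[of _ 0]) (auto simp: b top_box_def thr_def)
  qed
  then show "b \<in> top_box Q e ` {i. i < Q + 2 \<and> thr e i < e i}" by blast
qed

lemma top_box_maximal:
  assumes v: "valid Q e" and Q: "Q > 0" and i: "i < Q + 2" "thr e i < e i"
  shows "top_box Q e i \<in> maximal (shape Q e)"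
proof -
  note low = valid_low(1)[OF v] valid_low(2)[OF v Q]
  have "top_box Q e i \<in> shape Q e"
    using i by (auto simp: top_box_def shape_def)
  moreover have "\<not> below (top_box Q e i) (r, c)" if in_shape: "(r, c) \<in> shape Q e" for r c
  proof
    assume bel: "below (top_box Q e i) (r, c)"
    consider "i = 0" | "i = 1" | "2 \<le> i" by linarith
    then show False
    proof cases
      case 1
      then show False using bel in_shape i by (auto simp: below_def shape_def top_box_def)
    next
      case 2
      then show False using bel in_shape i by (auto simp: below_def shape_def top_box_def thr_def)
    next
      case 3
      \<comment> \<open>\<open>thr e 2\<close> is the length of row \<open>Q + 1\<close>. A row
        above it whose own bound is strict is strictly longer, so its last column has no box below
        row \<open>Q\<close>.\<close>
      have thr2: "thr e 2 < e i"
      proof (cases "i = 2")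
        case False
        then have "e 2 \<le> thr e i"
          using 3 i valid_mono[OF v, of 2 "i - 1"] by (auto simp: thr_def)
        then show ?thesis using i low(2) by (simp add: thr_def)
      qed (use i in simp)
      consider "r = Q + 2 - i" "e i < c" | "c = e i" "Q + 2 - i < r"
        using bel 3 by (auto simp: below_def top_box_def)
      then show False
      proof cases
        case 1
        then show False using in_shape 3 i by (auto simp: shape_def)
      next
        case c: 2
        show False
        proof (cases "r \<le> Q")
          case True
          then have "e i \<le> e (Q + 2 - r)" using in_shape c by (auto simp: shape_def)
          also have "\<dots> \<le> e (i - 1)" using True c 3 i by (intro valid_mono[OF v]) auto
          also have "\<dots> = thr e i" using True c 3 i by (auto simp: thr_def)
          finally show False using i by simp
        next
          case False
          then have "c = 1 \<and> 1 \<le> e 1 \<or> c = 2 \<and> 1 \<le> e 0"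
            using in_shape by (auto simp: shape_def)
          then show False using thr2 low c by (auto simp: thr_def)
        qed
      qed
    qed
  qed
  ultimately show ?thesis by (auto simp: maximal_def)
qed

lemma shape_remove:
  assumes v: "valid Q e" and i: "i < Q + 2" "thr e i < e i"
  shows "shape Q e - {top_box Q e i} = shape Q (e(i := e i - 1))"
proof -
  have "(r, c) \<in> shape Q e - {top_box Q e i} \<longleftrightarrow> (r, c) \<in> shape Q (e(i := e i - 1))" for r c
  proof (cases "r \<le> Q")
    case True
    then have "Q + 2 - r \<noteq> 0" "Q + 2 - r \<noteq> 1" by auto
    then show ?thesis
      using True i by (cases "i = Q + 2 - r") (auto simp: shape_def top_box_def)
  next
    case False
    then show ?thesis
      using i by (auto simp: shape_def top_box_def)
  qed
  then show ?thesis by auto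
qed

lemma inj_on_top_box: "inj_on (top_box Q e) {i. i < Q + 2 \<and> thr e i < e i}"
  by (rule inj_onI) (auto simp: top_box_def split: if_splits)

text \<open>Read backwards, such a word is a lazy walk in Young's lattice down to the empty shape:
  each step names a corner and either removes it or leaves it in place.\<close>

definition walks :: "nat \<Rightarrow> nat \<Rightarrow> (nat \<Rightarrow> nat) \<Rightarrow> nat" where
  "walks Q n e = card (words (shape Q e) n)"

lemma walks_Suc:
  assumes v: "valid Q e" and Q: "Q > 0"
  shows "walks Q (Suc n) e =
    (\<Sum>i<Q + 2. if thr e i < e i then walks Q n e + walks Q n (e(i := e i - 1)) else 0)"
proof -
  let ?I = "{i. i < Q + 2 \<and> thr e i < e i}"
  have max: "maximal (shape Q e) = top_box Q e ` ?I"
    using maximal_shape_subset[OF v Q] top_box_maximal[OF v Q] by blast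
  have "walks Q (Suc n) e = (\<Sum>i\<in>?I. card (words (shape Q e) n)
      + card (words (shape Q e - {top_box Q e i}) n))"
    unfolding walks_def card_words_Suc[OF finite_shape] max
    by (subst sum.reindex[OF inj_on_top_box]) simp
  also have "\<dots> = (\<Sum>i\<in>?I. walks Q n e + walks Q n (e(i := e i - 1)))"
    by (rule sum.cong) (auto simp: walks_def shape_remove[OF v])
  also have "\<dots> = (\<Sum>i<Q + 2. if thr e i < e i then walks Q n e + walks Q n (e(i := e i - 1)) else 0)"
    by (subst sum.inter_filter[symmetric]) (auto intro: sum.cong)
  finally show ?thesis .
qed

lemma walks_0: "walks Q 0 e = (if \<forall>i < Q + 2. e i = 0 then 1 else 0)"
proof -
  have "shape Q e = {} \<longleftrightarrow> (\<forall>i < Q + 2. e i = 0)"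
  proof
    assume empty: "shape Q e = {}"
    show "\<forall>i < Q + 2. e i = 0"
    proof (intro allI impI)
      fix i assume i: "i < Q + 2"
      have "e i = 0 \<or> (if i = 0 then (Suc Q, 2) else if i = 1 then (Suc Q, 1) else (Q + 2 - i, 1)) \<in> shape Q e"
        using i by (auto simp: shape_def)
      then show "e i = 0" using empty by simp
    qed
  qed (auto simp: shape_def)
  then show ?thesis by (simp add: walks_def card_words_0)
qed

lemma thr_cong: "(\<And>j. j < i \<Longrightarrow> e j = e' j) \<Longrightarrow> thr e i = thr e' i"
  by (auto simp: thr_def)

text \<open>The value at 0 is the number of parts greater than 1 after the first \<open>Q\<close> ones; \<open>part\<close> pads the
  partition with zeros just as the initial memory of the machine does.\<close>

definition profile :: "nat list \<Rightarrow> nat \<Rightarrow> nat \<Rightarrow> nat" where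
  "profile l Q i =
    (let part = (\<lambda>a. if a < length l then l ! a else 0) in
     if i = 0 then (LEAST j. part (Q + j) \<le> 1) else if i = 1 then length l - Q
     else part (Q + 1 - i))"

section \<open>Instances in coordinates\<close>

lemma instance_narrow:
  assumes "(l, N) \<in> instances p q" "(r, c) \<in> diagram l" "q + 2 < r"
  shows "c \<le> 2"
proof (rule ccontr)
  assume c: "\<not> c \<le> 2"
  obtain l0 where l0: "is_partition l0" "rank l0 = 2"
    and sub: "diagram l \<subseteq> diagram (replicate q p) \<union> diagram l0"
    using assms(1) by (auto simp: instances_def)
  \<comment> \<open>Row \<open>r\<close> is beyond the rectangle, so the box lies in
    \<open>l0\<close>. As also \<open>r \<ge> 3\<close> and \<open>c \<ge> 3\<close>, the box (3, 3)
    would lie in \<open>l0\<close>, against rank two; this explains the choice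
    \<open>Q = q + 2\<close>.\<close>
  have "(r, c) \<notin> diagram (replicate q p)" using assms(3) by (auto simp: diagram_def)
  then have rc: "(r, c) \<in> diagram l0" using sub assms(2) by blast
  have dec: "l0 ! j \<le> l0 ! i" if "i \<le> j" "j < length l0" for i j
    using that l0(1) by (cases "i = j") (auto simp: is_partition_def sorted_wrt_iff_nth_less)
  have diag: "(i, i) \<in> diagram l0" if "i \<in> {1..3}" for i
  proof -
    have r: "r \<le> length l0" "c \<le> l0 ! (r - 1)" using rc by (auto simp: diagram_def)
    then have "l0 ! (r - 1) \<le> l0 ! (i - 1)" using that assms(3) by (intro dec) auto
    then show ?thesis using r that c assms(3) by (auto simp: diagram_def)
  qed
  have "finite {i. (i, i) \<in> diagram l0}"
    by (rule finite_subset[of _ "{..length l0}"]) (auto simp: diagram_def)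
  then have "card {1..3::nat} \<le> rank l0"
    unfolding rank_def using diag by (intro card_mono) auto
  then show False using l0(2) by simp
qed

lemma shape_profile:
  assumes part: "is_partition l"
    and narrow: "\<And>r c. (r, c) \<in> diagram l \<Longrightarrow> Q < r \<Longrightarrow> c \<le> 2"
  shows "shape Q (profile l Q) = diagram l"
proof -
  define part where "part a = (if a < length l then l ! a else 0)" for a
  have dec: "part b \<le> part a" if "a \<le> b" for a b
    using that assms(1)
    by (cases "a = b") (auto simp: part_def is_partition_def sorted_wrt_iff_nth_less)
  define m where "m = (LEAST j. part (Q + j) \<le> 1)"
  have "part (Q + length l) \<le> 1" by (simp add: part_def)
  then have m: "part (Q + m) \<le> 1" unfolding m_def by (rule LeastI)
  have m': "1 < part (Q + j)" if "j < m" for j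
    using not_less_Least[of j "\<lambda>j. part (Q + j) \<le> 1"] that by (simp add: m_def)
  have diag: "(r, c) \<in> diagram l \<longleftrightarrow> 1 \<le> r \<and> 1 \<le> c \<and> c \<le> part (r - 1)" for r c
    by (auto simp: diagram_def part_def)
  have pos: "1 \<le> part a \<longleftrightarrow> a < length l" for a
    using assms(1) by (auto simp: part_def is_partition_def) (metis nth_mem not_gr0 Suc_leI)
  \<comment> \<open>Parts decrease, so the rows below row \<open>Q\<close> with at least two boxes
    form an initial run, and the minimum \<open>m\<close> is its length.\<close>
  have two: "2 \<le> part (r - 1) \<longleftrightarrow> r \<le> Q + m" if "Q < r" for r
  proof
    assume "2 \<le> part (r - 1)"
    then show "r \<le> Q + m" using m dec[of "Q + m" "r - 1"] by fastforce
  next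
    assume "r \<le> Q + m"
    then have "1 < part (Q + (r - 1 - Q))" using that by (intro m') auto
    then show "2 \<le> part (r - 1)" using that by simp
  qed
  have prof: "profile l Q 0 = m" "profile l Q 1 = length l - Q"
    "\<And>i. 2 \<le> i \<Longrightarrow> profile l Q i = part (Q + 1 - i)"
    by (auto simp: profile_def m_def part_def Let_def)
  have "(r, c) \<in> shape Q (profile l Q) \<longleftrightarrow> (r, c) \<in> diagram l" for r c
  proof (cases "r \<le> Q")
    case True
    have "r \<ge> 1 \<Longrightarrow> Q + 1 - (Q + 2 - r) = r - 1" using True by auto
    then show ?thesis using True prof(3)[of "Q + 2 - r"] by (auto simp: shape_def diag)
  next
    case False
    then have r: "Q < r" by simp
    have "c \<le> 2" if "c \<le> part (r - 1)" "1 \<le> c"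
      using narrow[of r c] that r by (auto simp: diag)
    moreover have "c = 0 \<or> c = 1 \<or> c = 2 \<or> 2 < c" by linarith
    moreover have "1 \<le> part (r - 1) \<longleftrightarrow> r \<le> Q + (length l - Q)"
      unfolding pos using r by arith
    ultimately show ?thesis
      using r two[OF r] unfolding shape_def diag prof by auto
  qed
  then show ?thesis by auto
qed

lemma valid_profile:
  assumes part: "is_partition l"
    and narrow: "\<And>r c. (r, c) \<in> diagram l \<Longrightarrow> Q < r \<Longrightarrow> c \<le> 2"
    and Q: "Q > 0"
  shows "valid Q (profile l Q)"
proof -
  define part where "part a = (if a < length l then l ! a else 0)" for a
  have dec: "part b \<le> part a" if "a \<le> b" for a b
    using that assms(1)
    by (cases "a = b") (auto simp: part_def is_partition_def sorted_wrt_iff_nth_less)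
  have pos: "1 \<le> part a \<longleftrightarrow> a < length l" for a
    using assms(1) by (auto simp: part_def is_partition_def) (metis nth_mem not_gr0 Suc_leI)
  define m where "m = (LEAST j. part (Q + j) \<le> 1)"
  have "\<not> Q + (length l - Q) < length l" by arith
  then have "part (Q + (length l - Q)) \<le> 1" by (simp add: part_def)
  then have m_le: "m \<le> length l - Q" unfolding m_def by (rule Least_le)
  have m': "1 < part (Q + j)" if "j < m" for j
    using not_less_Least[of j "\<lambda>j. part (Q + j) \<le> 1"] that by (simp add: m_def)
  have prof: "profile l Q 0 = m" "profile l Q 1 = length l - Q"
    "\<And>i. 2 \<le> i \<Longrightarrow> profile l Q i = part (Q + 1 - i)"
    by (auto simp: profile_def m_def part_def Let_def)
  show ?thesis unfolding valid_def
  proof (intro allI impI)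
    fix i assume i: "i < Q + 2"
    consider "i = 0" | "i = 1" | "i = 2" | "2 < i" by linarith
    then show "thr (profile l Q) i \<le> profile l Q i"
    proof cases
      case 3
      \<comment> \<open>The left-hand side is the length of row \<open>Q + 1\<close>; row
        \<open>Q\<close> is at list position \<open>Q - 1\<close>.\<close>
      have "min 1 m + min 1 (length l - Q) \<le> part (Q - 1)"
      proof (cases "m = 0")
        case True
        then show ?thesis using pos[of "Q - 1"] by (cases "Q < length l") auto
      next
        case False
        then show ?thesis using m'[of 0] dec[of "Q - 1" Q] by simp
      qed
      then show ?thesis using 3 prof(3)[of 2] unfolding thr_def prof(1,2) by simp
    next
      case 4
      have "profile l Q (i - 1) = part (Q + 1 - (i - 1))" "profile l Q i = part (Q + 1 - i)"
        using 4 by (intro prof(3); arith)+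
      moreover have "part (Q + 1 - (i - 1)) \<le> part (Q + 1 - i)" by (rule dec) simp
      ultimately show ?thesis using 4 by (simp add: thr_def)
    next
      case 1
      then show ?thesis by (simp add: thr_def)
    next
      case 2
      then show ?thesis using m_le unfolding thr_def 2 prof(2) by (simp add: prof(1))
    qed
  qed
qed

lemma finite_diagram: "finite (diagram l)"
proof (rule finite_subset)
  show "diagram l \<subseteq> (\<Union>r\<in>{1..length l}. {r} \<times> {..l ! (r - 1)})"
    by (auto simp: diagram_def)
qed auto

text \<open>A coordinate counts the boxes of one row, or of one column below row \<open>Q\<close>.
  Hence coordinates of an instance are at most \<open>N\<close> and serve as digits in base
  \<open>N + 1\<close>.\<close>

lemma profile_le_card_shape:
  assumes "i < Q + 2"
  shows "e i \<le> card (shape Q e)"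
proof -
  define f where "f j = (if i = 0 then (Q + j, 2) else if i = 1 then (Q + j, 1) else (Q + 2 - i, j))" for j
  have "f ` {1..e i} \<subseteq> shape Q e"
    using assms by (auto simp: f_def shape_def)
  moreover have "inj f" by (auto simp: f_def inj_def)
  ultimately show ?thesis
    using card_mono[OF finite_shape, of "f ` {1..e i}" Q e] card_image[of f "{1..e i}"]
    by (metis card_atLeastAtMost diff_Suc_1 inj_on_subset subset_UNIV)
qed

lemma length_le_boxes:
  assumes "is_partition l"
  shows "length l \<le> boxes l"
proof -
  have "0 < l ! (r - 1)" if "r \<in> {1..length l}" for r
  proof -
    have "l ! (r - 1) \<in> set l" using that by (intro nth_mem) auto
    then show ?thesis using assms by (metis is_partition_def not_gr0)
  qed
  then have "(\<lambda>r. (r, 1)) ` {1..length l} \<subseteq> diagram l"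
    by (force simp: diagram_def)
  then have "card ((\<lambda>r. (r, 1::nat)) ` {1..length l}) \<le> boxes l"
    unfolding boxes_def by (intro card_mono finite_diagram)
  then show ?thesis by (simp add: card_image inj_on_def)
qed

section \<open>Timed Hoare logic\<close>

text \<open>Step counts are exact. The inner \<open>Suc\<close> in the rules for \<open>Seq\<close>
  and \<open>While\<close> pays for discarding a finished \<open>Skip\<close>, the outer one for a
  test. Coin flips and digit reads have no rule, so only deterministic runs are described.\<close>

inductive big :: "com \<Rightarrow> state \<Rightarrow> nat \<Rightarrow> state \<Rightarrow> bool" where
  big_Skip: "big Skip s 0 s"
| big_Const: "big (Const r k) s 1 (set_reg r k s)"
| big_Add: "big (Add r a b) s 1 (set_reg r (reg s a + reg s b) s)"
| big_Sub: "big (Sub r a b) s 1 (set_reg r (reg s a - reg s b) s)"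
| big_Load: "big (Load r a) s 1 (set_reg r (mem s (reg s a)) s)"
| big_Store: "big (Store a r) s 1 (s\<lparr>mem := (mem s)(reg s a := reg s r)\<rparr>)"
| big_Seq: "big P s t s' \<Longrightarrow> big Q s' t' s'' \<Longrightarrow> big (Seq P Q) s (t + Suc t') s''"
| big_Cond_True: "reg s r \<noteq> 0 \<Longrightarrow> big P s t s' \<Longrightarrow> big (Cond r P Q) s (Suc t) s'"
| big_Cond_False: "reg s r = 0 \<Longrightarrow> big Q s t s' \<Longrightarrow> big (Cond r P Q) s (Suc t) s'"
| big_While_True: "reg s r \<noteq> 0 \<Longrightarrow> big P s t s' \<Longrightarrow> big (While r P) s' t' s'' \<Longrightarrow>
    big (While r P) s (Suc (t + Suc t')) s''"
| big_While_False: "reg s r = 0 \<Longrightarrow> big (While r P) s 1 s"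

text \<open>The list \<open>Qs\<close> is the continuation: a program always runs nested in the left arguments of
  \<open>Seq\<close>.\<close>

lemma step_foldl_Seq:
  "c \<noteq> Skip \<Longrightarrow> step (foldl Seq c Qs) s = map_pmf (\<lambda>(c', s'). (foldl Seq c' Qs, s')) (step c s)"
proof (induction Qs arbitrary: c)
  case Nil
  then show ?case by (simp add: pmf.map_ident case_prod_unfold)
next
  case (Cons Q Qs)
  then show ?case
    by (simp add: pmf.map_comp comp_def case_prod_unfold)
qed

lemma run_foldl_Seq:
  "step c s = return_pmf (c', s') \<Longrightarrow> c \<noteq> Skip \<Longrightarrow>
    run (Suc n) (foldl Seq c Qs, s) = run n (foldl Seq c' Qs, s')"
  by (simp add: step_foldl_Seq bind_return_pmf)

text \<open>Both \<open>Qs\<close> and \<open>n\<close> must be arbitrary: in the cases of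
  \<open>Seq\<close> and \<open>While\<close> the first part runs with the second pushed onto the
  continuation and its steps still to be made.\<close>

lemma big_run_foldl_Seq:
  "big c s t s' \<Longrightarrow> run (t + n) (foldl Seq c Qs, s) = run n (foldl Seq Skip Qs, s')"
proof (induction arbitrary: n Qs rule: big.induct)
  case (big_Seq P s t s' Q t' s'')
  have "run (t + Suc t' + n) (foldl Seq (Seq P Q) Qs, s)
      = run (t + (Suc t' + n)) (foldl Seq P (Q # Qs), s)"
    by (simp add: add.assoc)
  also have "\<dots> = run (Suc (t' + n)) (foldl Seq (Seq Skip Q) Qs, s')"
    using big_Seq.IH(1)[of "Suc (t' + n)" "Q # Qs"] by simp
  also have "\<dots> = run n (foldl Seq Skip Qs, s'')"
    using run_foldl_Seq[of "Seq Skip Q" s' Q s' "t' + n" Qs] big_Seq.IH(2)[of n Qs]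
    by (simp del: run.simps)
  finally show ?case .
next
  case (big_Cond_True s r P t s' Q)
  then show ?case by (simp only: add_Suc, subst run_foldl_Seq) auto
next
  case (big_Cond_False s r Q t s' P)
  then show ?case by (simp only: add_Suc, subst run_foldl_Seq) auto
next
  case (big_While_True s r P t s' t' s'')
  have "run (Suc (t + Suc t') + n) (foldl Seq (While r P) Qs, s)
      = run (t + (Suc t' + n)) (foldl Seq P (While r P # Qs), s)"
    using big_While_True.hyps by (simp only: add_Suc add.assoc, subst run_foldl_Seq) auto
  also have "\<dots> = run (Suc (t' + n)) (foldl Seq (Seq Skip (While r P)) Qs, s')"
    using big_While_True.IH(1)[of "Suc (t' + n)" "While r P # Qs"] by simp
  also have "\<dots> = run n (foldl Seq Skip Qs, s'')"
    using run_foldl_Seq[of "Seq Skip (While r P)" s' "While r P" s' "t' + n" Qs]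
      big_While_True.IH(2)[of n Qs]
    by (simp del: run.simps)
  finally show ?case .
qed (simp_all only: One_nat_def add_Suc add_0, (subst run_foldl_Seq; simp)+)

lemma big_run: "big c s t s' \<Longrightarrow> run t (c, s) = return_pmf (Skip, s')"
  using big_run_foldl_Seq[of c s t s' 0 "[]"] by simp

section \<open>Total correctness with time bounds\<close>

definition hoare :: "(state \<Rightarrow> bool) \<Rightarrow> com \<Rightarrow> nat \<Rightarrow> (state \<Rightarrow> bool) \<Rightarrow> bool" where
  "hoare P c T Q \<longleftrightarrow> (\<forall>s. P s \<longrightarrow> (\<exists>t s'. t \<le> T \<and> big c s t s' \<and> Q s'))"

lemma hoare_weaken:
  assumes "hoare P c T Q" and "\<And>s. P' s \<Longrightarrow> P s" "\<And>s. Q s \<Longrightarrow> Q' s" "T \<le> T'"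
  shows "hoare P' c T' Q'"
  using assms unfolding hoare_def by (meson order_trans)

lemma hoare_Seq:
  assumes "hoare P c T R" "hoare R d T' Q"
  shows "hoare P (Seq c d) (T + Suc T') Q"
  unfolding hoare_def
proof (intro allI impI)
  fix s assume "P s"
  then obtain t s1 where 1: "t \<le> T" "big c s t s1" "R s1"
    using assms(1) by (auto simp: hoare_def)
  then obtain t' s2 where 2: "t' \<le> T'" "big d s1 t' s2" "Q s2"
    using assms(2) by (auto simp: hoare_def)
  have "big (Seq c d) s (t + Suc t') s2" using 1 2 by (intro big_Seq)
  then show "\<exists>t s'. t \<le> T + Suc T' \<and> big (Seq c d) s t s' \<and> Q s'"
    using 1 2 by (intro exI[of _ "t + Suc t'"] exI[of _ s2]) simp
qed

text \<open>The invariant is indexed by the number of iterations still to come, which yields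
  termination and cost together. The \<open>+ 2\<close> pays for the test and for discarding
  \<open>Skip\<close> after the body, the final \<open>+ 1\<close> for the failing test.\<close>

lemma hoare_While:
  assumes body: "\<And>k. k < n \<Longrightarrow> hoare (I (Suc k)) c T (I k)"
    and test: "\<And>k s. k \<le> n \<Longrightarrow> I k s \<Longrightarrow> reg s r \<noteq> 0 \<longleftrightarrow> k \<noteq> 0"
  shows "hoare (I n) (While r c) (n * (T + 2) + 1) (I 0)"
  using assms
proof (induction n)
  case 0
  then show ?case unfolding hoare_def by (metis big_While_False le_add2 order_refl)
next
  case (Suc n)
  have IH: "hoare (I n) (While r c) (n * (T + 2) + 1) (I 0)"
    by (rule Suc.IH) (use Suc.prems in auto)
  show ?case unfolding hoare_def
  proof (intro allI impI)
    fix s assume s: "I (Suc n) s"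
    then obtain t s1 where 1: "t \<le> T" "big c s t s1" "I n s1"
      using Suc.prems(1)[of n] by (auto simp: hoare_def)
    then obtain t' s2 where 2: "t' \<le> n * (T + 2) + 1" "big (While r c) s1 t' s2" "I 0 s2"
      using IH by (auto simp: hoare_def)
    have "reg s r \<noteq> 0" using Suc.prems(2)[of "Suc n" s] s by simp
    then have "big (While r c) s (Suc (t + Suc t')) s2" using 1 2 by (intro big_While_True)
    then show "\<exists>t s'. t \<le> Suc n * (T + 2) + 1 \<and> big (While r c) s t s' \<and> I 0 s'"
      using 1 2 by (intro exI[of _ "Suc (t + Suc t')"] exI[of _ s2]) simp
  qed
qed

definition seqs :: "com list \<Rightarrow> com" where
  "seqs cs = foldr Seq cs Skip"

lemma seqs_simps [simp]: "seqs [] = Skip" "seqs (c # cs) = Seq c (seqs cs)"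
  by (simp_all add: seqs_def)

lemma hoare_Skip: "(\<And>s. P s \<Longrightarrow> Q s) \<Longrightarrow> hoare P Skip T Q"
  unfolding hoare_def by (metis big_Skip le0)

text \<open>Fixing the initial state allows a postcondition to refer to the original register
  contents.\<close>

lemma hoare_ghost: "(\<And>s0. P s0 \<Longrightarrow> hoare (\<lambda>s. s = s0) c T Q) \<Longrightarrow> hoare P c T Q"
  by (auto simp: hoare_def)

lemma hoare_seqs_Cons:
  "hoare P c T R \<Longrightarrow> hoare R (seqs cs) T' Q \<Longrightarrow> hoare P (seqs (c # cs)) (T + Suc T') Q"
  unfolding seqs_simps by (rule hoare_Seq)

lemma hoare_seqs_Nil: "hoare P (seqs []) 0 P"
  by (simp add: hoare_Skip)

text \<open>The loop over the coordinates is unrolled in the program text, their number being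
  constant; \<open>i\<close> is then a literal, not a register.\<close>

lemma hoare_seqs_map:
  assumes "\<And>i. i < n \<Longrightarrow> hoare (I i) (f i) T (I (Suc i))"
  shows "hoare (I 0) (seqs (map f [0..<n])) (n * Suc T) (I n)"
proof -
  have "i + k \<le> n \<Longrightarrow> hoare (I i) (seqs (map f [i..<i + k])) (k * Suc T) (I (i + k))" for i k
  proof (induction k arbitrary: i)
    case 0
    then show ?case by (simp add: hoare_Skip)
  next
    case (Suc k)
    have "hoare (I i) (Seq (f i) (seqs (map f [Suc i..<Suc i + k]))) (T + Suc (k * Suc T)) (I (Suc i + k))"
      using Suc.prems by (intro hoare_Seq[OF assms Suc.IH]) auto
    moreover have "[i..<i + Suc k] = i # [Suc i..<Suc i + k]" by (simp add: upt_conv_Cons del: upt_Suc)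
    ultimately show ?case by (simp add: algebra_simps del: upt_Suc)
  qed
  from this[of 0 n] show ?thesis by simp
qed

section \<open>Loop-free code\<close>

fun straight :: "com \<Rightarrow> bool" where
  "straight (Flip r) = False"
| "straight (Read_eps r) = False"
| "straight (Read_delta r) = False"
| "straight (While r P) = False"
| "straight (Seq P Q) = (straight P \<and> straight Q)"
| "straight (Cond r P Q) = (straight P \<and> straight Q)"
| "straight _ = True"

fun exec :: "com \<Rightarrow> state \<Rightarrow> state" where
  "exec (Const r k) s = set_reg r k s"
| "exec (Add r a b) s = set_reg r (reg s a + reg s b) s"
| "exec (Sub r a b) s = set_reg r (reg s a - reg s b) s"
| "exec (Load r a) s = set_reg r (mem s (reg s a)) s"
| "exec (Store a r) s = s\<lparr>mem := (mem s)(reg s a := reg s r)\<rparr>"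
| "exec (Seq P Q) s = exec Q (exec P s)"
| "exec (Cond r P Q) s = (if reg s r \<noteq> 0 then exec P s else exec Q s)"
| "exec _ s = s"

fun duration :: "com \<Rightarrow> nat" where
  "duration Skip = 0"
| "duration (Seq P Q) = duration P + Suc (duration Q)"
| "duration (Cond r P Q) = Suc (max (duration P) (duration Q))"
| "duration _ = 1"

lemma big_exec: "straight c \<Longrightarrow> \<exists>t \<le> duration c. big c s t (exec c s)"
proof (induction c arbitrary: s)
  case (Seq P Q)
  then obtain t t' where "t \<le> duration P" "big P s t (exec P s)"
    "t' \<le> duration Q" "big Q (exec P s) t' (exec Q (exec P s))" by fastforce
  then show ?case by (intro exI[of _ "t + Suc t'"]) (simp add: big_Seq del: add_Suc_right)
next
  case (Cond r P Q)
  then obtain t t' where "t \<le> duration P" and "big P s t (exec P s)"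
    and "t' \<le> duration Q" and "big Q s t' (exec Q s)" by fastforce
  show ?case
  proof (cases "reg s r = 0")
    case True
    then have "big (Cond r P Q) s (Suc t') (exec (Cond r P Q) s)"
      using big_Cond_False[OF True] \<open>big Q s t' (exec Q s)\<close> by simp
    then show ?thesis using \<open>t' \<le> duration Q\<close> by (intro exI[of _ "Suc t'"]) auto
  next
    case False
    then have "big (Cond r P Q) s (Suc t) (exec (Cond r P Q) s)"
      using big_Cond_True[OF False] \<open>big P s t (exec P s)\<close> by simp
    then show ?thesis using \<open>t \<le> duration P\<close> by (intro exI[of _ "Suc t"]) auto
  qed
qed (auto intro!: exI[of _ 1] big_Skip big_Const big_Add big_Sub big_Load big_Store simp del: One_nat_def)

text \<open>Symbolic execution: \<open>exec\<close> and \<open>duration\<close> are functions, so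
  the simplifier computes the final state and the cost.\<close>

lemma hoare_straight:
  assumes "straight c" "\<And>s. P s \<Longrightarrow> Q (exec c s)" "duration c \<le> T"
  shows "hoare P c T Q"
  unfolding hoare_def using big_exec[OF assms(1)] assms(2,3) by (meson order_trans)

lemma reg_set_reg [simp]: "reg (set_reg r v s) a = (if a = r then v else reg s a)"
  by (simp add: set_reg_def)

lemma mem_set_reg [simp]: "mem (set_reg r v s) = mem s"
  by (simp add: set_reg_def)

lemma set_reg_idem: "reg s r = v \<Longrightarrow> set_reg r v s = s"
  by (auto simp: set_reg_def)

lemma set_reg_overwrite: "set_reg r v (set_reg r w s) = set_reg r v s"
  by (simp add: set_reg_def)

lemma set_reg_commute: "a \<noteq> b \<Longrightarrow> set_reg a v (set_reg b w s) = set_reg b w (set_reg a v s)"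
  by (simp add: set_reg_def fun_upd_twist)

text \<open>Register 2 holds the constant 1 in all programs.\<close>

definition mul_add :: "nat \<Rightarrow> nat \<Rightarrow> nat \<Rightarrow> com" where
  "mul_add d a c = While c (seqs [Add d d a, Sub c c 2])"

text \<open>Repeated addition takes time linear in register \<open>c\<close>, so the program always
  places the small factor there, which is at most \<open>N + 1\<close>.\<close>

lemma hoare_mul_add:
  assumes distinct: "distinct [d, a, c, 2]"
    and pre: "\<And>s. P s \<Longrightarrow> reg s 2 = 1 \<and> reg s c \<le> n"
    and post: "\<And>s. P s \<Longrightarrow> Q (set_reg c 0 (set_reg d (reg s d + reg s a * reg s c) s))"
    and T: "6 * n + 1 \<le> T"
  shows "hoare P (mul_add d a c) T Q"
  unfolding hoare_def
proof (intro allI impI)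
  fix s assume s: "P s"
  \<comment> \<open>An equation for the whole state, which also records that nothing else
    changes.\<close>
  define I where "I k s' \<longleftrightarrow> k \<le> reg s c \<and>
    s' = set_reg c k (set_reg d (reg s d + reg s a * (reg s c - k)) s)" for k s'
  have "hoare (I (reg s c)) (mul_add d a c) (reg s c * (4 + 2) + 1) (I 0)"
    unfolding mul_add_def
  proof (rule hoare_While)
    fix k assume "k < reg s c"
    then have k: "reg s c - k = Suc (reg s c - Suc k)" by simp
    show "hoare (I (Suc k)) (seqs [Add d d a, Sub c c 2]) 4 (I k)"
    proof (rule hoare_straight)
      fix s' assume "I (Suc k) s'"
      then show "I k (exec (seqs [Add d d a, Sub c c 2]) s')"
        using distinct pre[OF s] \<open>k < reg s c\<close> unfolding I_def k
        by (auto simp: set_reg_overwrite set_reg_commute[of d c] algebra_simps)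
    qed auto
  qed (auto simp: I_def)
  moreover have "I (reg s c) s"
    using distinct by (simp add: I_def set_reg_idem)
  ultimately obtain t s' where t: "t \<le> reg s c * (4 + 2) + 1" "big (mul_add d a c) s t s'" "I 0 s'"
    unfolding hoare_def by blast
  have "reg s c \<le> n" using pre[OF s] by simp
  then have "t \<le> T" using t(1) T by simp
  moreover have "Q s'" using t(3) post[OF s] by (simp add: I_def)
  ultimately show "\<exists>t s'. t \<le> T \<and> big (mul_add d a c) s t s' \<and> Q s'" using t by blast
qed

section \<open>The table\<close>

definition dig :: "nat \<Rightarrow> nat \<Rightarrow> nat \<Rightarrow> nat" where
  "dig B z i = z div B ^ i mod B"

lemma dig_mod:
  assumes "j < i"
  shows "dig B (z mod B ^ i) j = dig B z j"
proof -
  obtain k where k: "i = j + Suc k" using assms less_imp_Suc_add by auto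
  have "z mod B ^ i div B ^ j = z div B ^ j mod B ^ Suc k"
  proof (cases "B = 0")
    case True
    then show ?thesis by (cases j) (simp_all add: k)
  next
    case False
    then show ?thesis
      using mod_mult2_eq[of z "B ^ j" "B ^ Suc k"] by (simp only: k power_add) simp
  qed
  moreover have "z div B ^ j mod B ^ Suc k mod B = z div B ^ j mod B"
    by (rule mod_mod_cancel) simp
  ultimately show ?thesis by (simp add: dig_def)
qed

lemma diff_power_div_mod:
  fixes z :: nat
  assumes "B ^ i \<le> z" "0 < B"
  shows "(z - B ^ i) div B ^ i = z div B ^ i - 1" "(z - B ^ i) mod B ^ i = z mod B ^ i"
proof -
  obtain y where z: "z = y + B ^ i" using assms(1) le_Suc_ex by (metis add.commute)
  show "(z - B ^ i) div B ^ i = z div B ^ i - 1" "(z - B ^ i) mod B ^ i = z mod B ^ i"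
    using assms(2) by (simp_all add: z)
qed

lemma diff_1_div_mod:
  fixes y :: nat
  assumes "0 < y mod B" "0 < B"
  shows "(y - 1) div B = y div B" "(y - 1) mod B = y mod B - 1"
proof -
  have less: "y mod B - 1 < B" using assms(2) mod_less_divisor[of B y] by linarith
  have y: "y - 1 = y div B * B + (y mod B - 1)"
    using div_mult_mod_eq[of y B] assms(1) by linarith
  show "(y - 1) div B = y div B" "(y - 1) mod B = y mod B - 1"
    unfolding y using less assms(2) by simp_all
qed

text \<open>A positive digit \<open>i\<close> absorbs the subtraction, so no borrow reaches the
  higher positions.\<close>

lemma diff_power_above:
  assumes "0 < dig B z i" "i < k" and B: "0 < B"
  shows "(z - B ^ i) div B ^ k = z div B ^ k"
proof -
  obtain j where k: "k = i + Suc j" using assms(2) less_imp_Suc_add by auto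
  have pos: "0 < z div B ^ i mod B" using assms(1) by (simp add: dig_def)
  then have "B ^ i \<le> z" by (cases "z < B ^ i") simp_all
  have split: "x div B ^ k = x div B ^ i div B div B ^ j" for x
    by (simp only: k power_add power_Suc div_mult2_eq)
  have "(z - B ^ i) div B ^ k = (z div B ^ i - 1) div B div B ^ j"
    unfolding split by (simp only: diff_power_div_mod[OF \<open>B ^ i \<le> z\<close> B])
  also have "\<dots> = z div B ^ k"
    unfolding split by (simp only: diff_1_div_mod(1)[OF pos B])
  finally show ?thesis .
qed

lemma dig_diff_power:
  assumes "0 < dig B z i" "1 < B"
  shows "dig B (z - B ^ i) = (dig B z)(i := dig B z i - 1)"
proof
  fix j
  have pos: "0 < z div B ^ i mod B" using assms(1) by (simp add: dig_def)
  then have le: "B ^ i \<le> z" by (cases "z < B ^ i") simp_all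
  consider "j < i" | "j = i" | "i < j" by linarith
  then show "dig B (z - B ^ i) j = ((dig B z)(i := dig B z i - 1)) j"
  proof cases
    case 1
    then have "dig B (z - B ^ i) j = dig B z j"
      using dig_mod[OF 1, of B "z - B ^ i"] dig_mod[OF 1, of B z] diff_power_div_mod(2)[OF le] assms(2)
      by simp
    then show ?thesis using 1 by simp
  next
    case 2
    have "(z div B ^ i - 1) mod B = z div B ^ i mod B - 1"
      using diff_1_div_mod(2)[OF pos] assms(2) by simp
    then show ?thesis using 2 diff_power_div_mod(1)[OF le] assms(2) by (simp add: dig_def)
  next
    case 3
    then show ?thesis using diff_power_above[OF assms(1) 3] assms(2) by (simp add: dig_def)
  qed
qed

lemma dig_diff_power_low:
  assumes "B ^ k \<le> z" "0 < B" "i < k"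
  shows "dig B (z - B ^ k) i = dig B z i"
  using dig_mod[OF assms(3), of B "z - B ^ k"] dig_mod[OF assms(3), of B z] diff_power_div_mod[OF assms(1,2)]
  by simp

lemma sum_digits_less:
  fixes x :: "nat \<Rightarrow> nat"
  assumes "\<And>i. i < k \<Longrightarrow> x i < B"
  shows "(\<Sum>i<k. x i * B ^ i) < B ^ k"
  using assms
proof (induction k)
  case (Suc k)
  then have "(\<Sum>i<k. x i * B ^ i) < B ^ k" "Suc (x k) \<le> B" by (auto simp: Suc_leI)
  then have "(\<Sum>i<k. x i * B ^ i) + x k * B ^ k < Suc (x k) * B ^ k" by simp
  also have "\<dots> \<le> B * B ^ k" using \<open>Suc (x k) \<le> B\<close> by (rule mult_le_mono1)
  finally show ?case by simp
qed simp

lemma dig_sum: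
  fixes x :: "nat \<Rightarrow> nat"
  assumes "\<And>i. i < k \<Longrightarrow> x i < B" and "j < k"
  shows "dig B (M * B ^ k + (\<Sum>i<k. x i * B ^ i)) j = x j"
  using assms
proof (induction k arbitrary: M)
  case (Suc k)
  have eq: "M * B ^ Suc k + (\<Sum>i<Suc k. x i * B ^ i) = (M * B + x k) * B ^ k + (\<Sum>i<k. x i * B ^ i)"
    by (simp add: algebra_simps)
  show ?case
  proof (cases "j = k")
    case True
    have "0 < B" "x k < B" using Suc.prems(1)[of k] by auto
    moreover have "(\<Sum>i<k. x i * B ^ i) < B ^ k" using Suc.prems(1) by (intro sum_digits_less) auto
    ultimately show ?thesis unfolding eq True by (simp add: dig_def)
  next
    case False
    then show ?thesis unfolding eq using Suc by auto
  qed
qed simp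

lemma div_sum:
  fixes x :: "nat \<Rightarrow> nat"
  assumes "\<And>i. i < k \<Longrightarrow> x i < B"
  shows "(M * B ^ k + (\<Sum>i<k. x i * B ^ i)) div B ^ k = M"
proof (rule div_nat_eqI)
  have "(\<Sum>i<k. x i * B ^ i) < B ^ k" using assms by (rule sum_digits_less)
  then show "M * B ^ k + (\<Sum>i<k. x i * B ^ i) < B ^ k * Suc M" by simp
qed simp

section \<open>Correctness of the table\<close>

lemma shape_cong:
  assumes "\<And>i. i < Q + 2 \<Longrightarrow> e i = e' i"
  shows "shape Q e = shape Q e'"
proof -
  have "e (Q + 2 - r) = e' (Q + 2 - r)" if "1 \<le> r" for r using that by (intro assms) auto
  moreover have "e 0 = e' 0" "e 1 = e' 1" by (auto intro!: assms)
  ultimately show ?thesis by (auto simp: shape_def)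
qed

lemma walks_cong: "(\<And>i. i < Q + 2 \<Longrightarrow> e i = e' i) \<Longrightarrow> walks Q n e = walks Q n e'"
  using shape_cong[of Q e e'] by (simp add: walks_def)

lemma valid_cong:
  assumes "\<And>i. i < Q + 2 \<Longrightarrow> e i = e' i"
  shows "valid Q e \<longleftrightarrow> valid Q e'"
proof -
  have "thr e i = thr e' i" if "i < Q + 2" for i
    using that by (intro thr_cong assms) auto
  then show ?thesis using assms by (simp add: valid_def)
qed

text \<open>The number of words of length \<open>n\<close> for coordinates \<open>e\<close> is stored at the address whose lowest \<open>Q + 2\<close>
  base-\<open>B\<close> digits are \<open>e\<close> and whose leading part is \<open>n + 1\<close>, so that the table starts beyond the input.
  Cells with invalid coordinates contain garbage that is never used.\<close>

definition table_correct :: "nat \<Rightarrow> nat \<Rightarrow> (nat \<Rightarrow> nat) \<Rightarrow> nat \<Rightarrow> bool" where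
  "table_correct Q B m z \<longleftrightarrow>
    (\<forall>a. B ^ (Q + 2) \<le> a \<and> a < z \<and> valid Q (dig B a) \<longrightarrow>
       m a = walks Q (a div B ^ (Q + 2) - 1) (dig B a))"

text \<open>One summand of \<open>walks_Suc\<close> in terms of addresses:
  \<open>B ^ (Q + 2)\<close> is the size of a layer, so subtracting it shortens the words by one
  letter, and \<open>B ^ i\<close> removes the corner.\<close>

definition gain :: "nat \<Rightarrow> nat \<Rightarrow> (nat \<Rightarrow> nat) \<Rightarrow> nat \<Rightarrow> nat \<Rightarrow> nat" where
  "gain Q B m z i =
    (if thr (dig B z) i < dig B z i
     then m (z - B ^ (Q + 2)) + m (z - B ^ (Q + 2) - B ^ i) else 0)"

lemma table_correct_Suc:
  assumes tab: "table_correct Q B m z" and z: "2 * B ^ (Q + 2) \<le> z" and "1 < B" "0 < Q"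
  shows "table_correct Q B (m(z := \<Sum>i<Q + 2. gain Q B m z i)) (Suc z)"
proof -
  \<comment> \<open>The leading part of \<open>z\<close> is the word length plus 1, so
    \<open>?n\<close> is the length that belongs to the previous layer.\<close>
  let ?K = "Q + 2" let ?S = "B ^ ?K" let ?e = "dig B z" let ?n = "z div ?S - 2"
  define y where "y = z - ?S"
  have S: "0 < ?S" using assms(3) by simp
  have Sz: "?S \<le> z" using z by simp
  have div: "2 \<le> z div ?S" using z by (subst less_eq_div_iff_mult_less_eq[OF S])
  have y_ge: "?S \<le> y" using z by (simp add: y_def)
  have y_less: "y < z" unfolding y_def using Sz S by (intro diff_less) linarith+
  have y_div: "y div ?S - 1 = ?n"
    using diff_power_div_mod(1)[OF Sz] assms(3) by (simp add: y_def)
  have y_dig: "dig B y i = ?e i" if "i < ?K" for i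
    unfolding y_def using dig_diff_power_low[OF Sz _ that] assms(3) by simp
  have "(\<Sum>i<?K. gain Q B m z i) = walks Q (z div ?S - 1) ?e" if v: "valid Q ?e"
  proof -
    have my: "m y = walks Q ?n ?e"
    proof -
      have "valid Q (dig B y)" using v valid_cong[of Q "dig B y" ?e] y_dig by blast
      then have "m y = walks Q (y div ?S - 1) (dig B y)"
        using tab y_ge y_less by (simp add: table_correct_def)
      also have "\<dots> = walks Q ?n ?e" unfolding y_div using y_dig by (rule walks_cong)
      finally show ?thesis .
    qed
    have mi: "m (y - B ^ i) = walks Q ?n (?e(i := ?e i - 1))" if i: "i < ?K" "thr ?e i < ?e i" for i
    proof -
      let ?a = "y - B ^ i"
      have pos: "0 < dig B y i" using y_dig i by simp
      have a_div: "?a div ?S = y div ?S" using diff_power_above[OF pos i(1)] assms(3) by simp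
      have a_dig: "dig B ?a j = (?e(i := ?e i - 1)) j" if "j < ?K" for j
        using dig_diff_power[OF pos assms(3)] y_dig that i(1) by simp
      have "0 < ?a div ?S" unfolding a_div using y_ge S by (simp add: div_greater_zero_iff)
      then have "?S \<le> ?a" by (simp add: div_greater_zero_iff)
      moreover have "?a < z" using y_less by simp
      moreover have "valid Q (dig B ?a)"
        using valid_remove[OF v i(2)] valid_cong[of Q "dig B ?a"] a_dig by blast
      ultimately have "m ?a = walks Q (?a div ?S - 1) (dig B ?a)"
        using tab by (simp add: table_correct_def)
      also have "\<dots> = walks Q ?n (?e(i := ?e i - 1))"
        unfolding a_div y_div using a_dig by (rule walks_cong)
      finally show ?thesis .
    qed
    have "z div ?S - 1 = Suc ?n" using div by simp
    then show ?thesis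
      unfolding walks_Suc[OF v assms(4)] \<open>z div ?S - 1 = Suc ?n\<close>
      using my mi by (intro sum.cong) (auto simp: gain_def y_def)
  qed
  then show ?thesis
    using tab by (auto simp: table_correct_def less_Suc_eq)
qed

text \<open>The layer of length 0: the only word is the empty one, its shape is empty, and all
  digits of its cell below the leading part are 0. The zeros of the fresh memory are right
  everywhere else.\<close>

lemma table_correct_initial:
  assumes "1 < B" and zero: "\<And>a. B ^ (Q + 2) < a \<Longrightarrow> m a = 0" and one: "m (B ^ (Q + 2)) = 1"
  shows "table_correct Q B m (2 * B ^ (Q + 2))"
  unfolding table_correct_def
proof (intro allI impI, elim conjE)
  let ?K = "Q + 2" let ?S = "B ^ ?K"
  fix a assume a: "?S \<le> a" "a < 2 * ?S"
  have S: "0 < ?S" using assms(1) by simp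
  have div: "a div ?S = 1" using a by (intro div_nat_eqI) simp_all
  have digits: "(\<forall>i<?K. dig B a i = 0) \<longleftrightarrow> a = ?S"
  proof
    assume "a = ?S"
    then show "\<forall>i<?K. dig B a i = 0"
      using dig_sum[of ?K "\<lambda>_. 0" B _ 1] assms(1) by auto
  next
    assume dig: "\<forall>i<?K. dig B a i = 0"
    have "a mod B ^ i = 0" if "i \<le> ?K" for i
      using that
    proof (induction i)
      case (Suc i)
      then have "a div B ^ i mod B = 0" using dig by (simp add: dig_def)
      then show ?case using Suc by (simp add: mod_mult2_eq mult.commute[of B])
    qed simp
    then show "a = ?S" using div by (metis mult_1_right add.right_neutral mult_div_mod_eq order_refl)
  qed
  have "m a = (if a = ?S then 1 else 0)"
    using a zero[of a] one by (cases "a = ?S") simp_all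
  then show "m a = walks Q (a div ?S - 1) (dig B a)"
    unfolding div diff_self_eq_0 walks_0 digits .
qed

lemma table_correct_final:
  assumes tab: "table_correct Q B m ((N + 2) * B ^ (Q + 2))" and v: "valid Q e"
    and e: "\<And>i. i < Q + 2 \<Longrightarrow> e i < B"
  shows "m ((N + 1) * B ^ (Q + 2) + (\<Sum>i<Q + 2. e i * B ^ i)) = walks Q N e"
proof -
  let ?a = "(N + 1) * B ^ (Q + 2) + (\<Sum>i<Q + 2. e i * B ^ i)"
  have dig: "dig B ?a i = e i" if "i < Q + 2" for i using dig_sum[OF e that] .
  have "(\<Sum>i<Q + 2. e i * B ^ i) < B ^ (Q + 2)" using e by (rule sum_digits_less)
  then have "?a < (N + 2) * B ^ (Q + 2)" by simp
  moreover have div: "?a div B ^ (Q + 2) = N + 1" using e by (rule div_sum)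
  moreover have "valid Q (dig B ?a)" using v valid_cong[of Q "dig B ?a" e] dig by blast
  ultimately have "m ?a = walks Q (?a div B ^ (Q + 2) - 1) (dig B ?a)"
    using tab by (simp add: table_correct_def)
  also have "\<dots> = walks Q N (dig B ?a)" unfolding div by simp
  also have "\<dots> = walks Q N e" using dig by (rule walks_cong)
  finally show ?thesis .
qed

section \<open>The program\<close>

declare power_Suc [simp del]

lemma div_power_Suc: "z div b ^ i div b = (z :: nat) div b ^ Suc i"
  by (simp only: power_Suc2 div_mult2_eq)

text \<open>
  Register allocation: 0 and 3 hold \<open>N\<close> and the base \<open>B = N + 1\<close>, 2 the constant 1, 15 the constant 0,
  4 the current power of \<open>B\<close>, 5 the address of the result, 8 the number \<open>B ^ (Q + 2)\<close> of cells per
  layer, 9 the current cell, 10 the number of cells still to be filled, 11 the digits not yet read,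
  18 the last digit read, 13 the accumulated cell value and 14 the bound \<open>thr\<close>.
  The others are scratch registers.\<close>

definition scale :: com where
  "scale = seqs [seqs [Add 6 3 15, Sub 7 7 7], mul_add 7 4 6, Add 4 7 15]"

lemma hoare_scale:
  assumes pre: "\<And>s. P s \<Longrightarrow> reg s 2 = 1 \<and> reg s 15 = 0 \<and> reg s 3 = B"
    and post: "\<And>s s'. P s \<Longrightarrow> mem s' = mem s \<Longrightarrow> reg s' 4 = reg s 4 * B \<Longrightarrow>
      (\<And>r. r \<notin> {4, 6, 7} \<Longrightarrow> reg s' r = reg s r) \<Longrightarrow> Q s'"
  shows "hoare P scale (6 * B + 20) Q"
proof (rule hoare_ghost)
  fix s0 assume s0: "P s0"
  let ?A = "\<lambda>s. mem s = mem s0 \<and> (\<forall>r. r \<notin> {4, 6, 7} \<longrightarrow> reg s r = reg s0 r)"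
  have 1: "hoare (\<lambda>s. s = s0) (seqs [Add 6 3 15, Sub 7 7 7]) 5
      (\<lambda>s. ?A s \<and> reg s 4 = reg s0 4 \<and> reg s 6 = B \<and> reg s 7 = 0)"
    by (rule hoare_straight) (use pre[OF s0] in auto)
  have 2: "hoare (\<lambda>s. ?A s \<and> reg s 4 = reg s0 4 \<and> reg s 6 = B \<and> reg s 7 = 0) (mul_add 7 4 6) (6 * B + 1)
      (\<lambda>s. ?A s \<and> reg s 7 = reg s0 4 * B)"
    by (rule hoare_mul_add[where n = B]) (use pre[OF s0] in auto)
  have 3: "hoare (\<lambda>s. ?A s \<and> reg s 7 = reg s0 4 * B) (Add 4 7 15) 1 Q"
    by (rule hoare_straight) (use pre[OF s0] in \<open>auto intro!: post[OF s0]\<close>)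
  show "hoare (\<lambda>s. s = s0) scale (6 * B + 20) Q"
    unfolding scale_def
    by (rule hoare_weaken[OF hoare_seqs_Cons[OF 1 hoare_seqs_Cons[OF 2 hoare_seqs_Cons[OF 3 hoare_seqs_Nil]]]]) auto
qed

text \<open>Division by \<open>B\<close> through repeated subtraction. By truncation, register 7
  (register 11 minus \<open>N\<close>) is nonzero exactly as long as another
  \<open>B = N + 1\<close> fits.\<close>

definition next_digit :: com where
  "next_digit = seqs [seqs [Sub 12 12 12, Sub 7 11 0],
     While 7 (seqs [Sub 11 11 3, Add 12 12 2, Sub 7 11 0]), seqs [Add 18 11 15, Add 11 12 15]]"

lemma hoare_next_digit:
  assumes pre: "\<And>s. P s \<Longrightarrow> reg s 2 = 1 \<and> reg s 15 = 0 \<and> reg s 3 = Suc N \<and> reg s 0 = N \<and> reg s 11 \<le> z"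
    and post: "\<And>s s'. P s \<Longrightarrow> mem s' = mem s \<Longrightarrow>
      reg s' 11 = reg s 11 div Suc N \<Longrightarrow> reg s' 18 = reg s 11 mod Suc N \<Longrightarrow>
      (\<And>r. r \<notin> {7, 11, 12, 18} \<Longrightarrow> reg s' r = reg s r) \<Longrightarrow> Q s'"
  shows "hoare P next_digit (8 * z + 20) Q"
proof (rule hoare_ghost)
  fix s0 assume s0: "P s0"
  let ?A = "\<lambda>s. mem s = mem s0 \<and> (\<forall>r. r \<notin> {7, 11, 12, 18} \<longrightarrow> reg s r = reg s0 r)"
  let ?y = "reg s0 11"
  define I where "I k s \<longleftrightarrow> ?A s \<and> reg s 11 = k * Suc N + ?y mod Suc N \<and> reg s 12 + k = ?y div Suc N
    \<and> reg s 7 = reg s 11 - N" for k and s :: state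
  have yz: "?y div Suc N \<le> z" using pre[OF s0] by (meson div_le_dividend order_trans)
  have 1: "hoare (\<lambda>s. s = s0) (seqs [Sub 12 12 12, Sub 7 11 0]) 5 (I (?y div Suc N))"
    by (rule hoare_straight)
      (use pre[OF s0] div_mult_mod_eq[of ?y "Suc N"] in \<open>auto simp: I_def\<close>)
  have 2: "hoare (I (?y div Suc N)) (While 7 (seqs [Sub 11 11 3, Add 12 12 2, Sub 7 11 0]))
      (?y div Suc N * (6 + 2) + 1) (I 0)"
  proof (rule hoare_While)
    fix k
    show "hoare (I (Suc k)) (seqs [Sub 11 11 3, Add 12 12 2, Sub 7 11 0]) 6 (I k)"
      by (rule hoare_straight) (use pre[OF s0] in \<open>auto simp: I_def\<close>)
  next
    fix k s assume I: "I k s"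
    have "?y mod Suc N \<le> N" using mod_less_divisor[of "Suc N" ?y] by linarith
    then show "reg s 7 \<noteq> 0 \<longleftrightarrow> k \<noteq> 0" using I by (cases k) (auto simp: I_def)
  qed
  have 3: "hoare (I 0) (seqs [Add 18 11 15, Add 11 12 15]) 5 Q"
  proof (rule hoare_straight)
    fix s assume "I 0 s"
    then show "Q (exec (seqs [Add 18 11 15, Add 11 12 15]) s)"
      using pre[OF s0] by (intro post[OF s0]) (auto simp: I_def)
  qed auto
  show "hoare (\<lambda>s. s = s0) next_digit (8 * z + 20) Q"
    unfolding next_digit_def
    by (rule hoare_weaken[OF hoare_seqs_Cons[OF 1 hoare_seqs_Cons[OF 2 hoare_seqs_Cons[OF 3 hoare_seqs_Nil]]]])
      (use yz in auto)
qed

section \<open>Filling the table\<close>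

definition fetch :: com where
  "fetch = seqs [Sub 7 18 14, Cond 7 (seqs [Sub 16 9 8, Load 17 16, Add 13 13 17,
     Sub 16 16 4, Load 17 16, Add 13 13 17]) Skip]"

text \<open>Prepares the bound for coordinate \<open>i + 1\<close>. This is the digit just read,
  except for \<open>i = 1\<close>: register 14 then still holds \<open>e 0\<close>, as
  \<open>thr e 1 = e 0\<close>, and both counts are cut down to 0 or 1.\<close>

definition update_thr :: "nat \<Rightarrow> com" where
  "update_thr i =
     (if i = 1 then seqs [Cond 14 (Const 14 1) Skip, Cond 18 (Add 14 14 2) Skip] else Add 14 18 15)"

definition cell_step :: "nat \<Rightarrow> com" where
  "cell_step i = seqs [next_digit, seqs [fetch, update_thr i], scale]"

definition fill_cell :: "nat \<Rightarrow> com" where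
  "fill_cell Q = seqs [seqs [Add 11 9 15, Sub 13 13 13, Sub 14 14 14, Const 4 1],
     seqs (map cell_step [0..<Q + 2]), seqs [Store 9 13, Add 9 9 2, Sub 10 10 2]]"

definition globals :: "nat \<Rightarrow> nat \<Rightarrow> nat \<Rightarrow> state \<Rightarrow> bool" where
  "globals Q N a s \<longleftrightarrow> reg s 0 = N \<and> reg s 2 = 1 \<and> reg s 3 = Suc N \<and> reg s 5 = a \<and>
     reg s 8 = Suc N ^ (Q + 2) \<and> reg s 15 = 0"

definition cell_inv :: "nat \<Rightarrow> nat \<Rightarrow> nat \<Rightarrow> nat \<Rightarrow> nat \<Rightarrow> (nat \<Rightarrow> nat) \<Rightarrow> nat \<Rightarrow> state \<Rightarrow> bool" where
  "cell_inv Q N a k z m i s \<longleftrightarrow> globals Q N a s \<and> mem s = m \<and> reg s 4 = Suc N ^ i \<and> reg s 9 = z \<and>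
     reg s 10 = k \<and> reg s 11 = z div Suc N ^ i \<and> reg s 13 = (\<Sum>j<i. gain Q (Suc N) m z j) \<and>
     reg s 14 = thr (dig (Suc N) z) i"

lemma hoare_cell_step:
  "hoare (cell_inv Q N a k z m i) (cell_step i) (8 * z + 6 * N + 100) (cell_inv Q N a k z m (Suc i))"
proof -
  let ?R1 = "\<lambda>s. globals Q N a s \<and> mem s = m \<and> reg s 4 = Suc N ^ i \<and> reg s 9 = z \<and>
     reg s 10 = k \<and> reg s 11 = z div Suc N ^ Suc i \<and> reg s 13 = (\<Sum>j<i. gain Q (Suc N) m z j) \<and>
     reg s 14 = thr (dig (Suc N) z) i \<and> reg s 18 = dig (Suc N) z i"
  let ?R2 = "\<lambda>s. globals Q N a s \<and> mem s = m \<and> reg s 4 = Suc N ^ i \<and> reg s 9 = z \<and>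
     reg s 10 = k \<and> reg s 11 = z div Suc N ^ Suc i \<and> reg s 13 = (\<Sum>j<Suc i. gain Q (Suc N) m z j) \<and>
     reg s 14 = thr (dig (Suc N) z) (Suc i)"
  have 1: "hoare (cell_inv Q N a k z m i) next_digit (8 * z + 20) ?R1"
    by (rule hoare_next_digit)
      (auto simp: cell_inv_def globals_def dig_def div_power_Suc)
  have 2: "hoare ?R1 (seqs [fetch, update_thr i]) 30 ?R2"
  proof (rule hoare_straight)
    fix s assume s: "?R1 s"
    define s1 where "s1 = exec fetch s"
    have s1: "globals Q N a s1 \<and> mem s1 = m \<and> reg s1 4 = Suc N ^ i \<and> reg s1 9 = z \<and>
        reg s1 10 = k \<and> reg s1 11 = z div Suc N ^ Suc i \<and> reg s1 13 = (\<Sum>j<Suc i. gain Q (Suc N) m z j) \<and>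
        reg s1 14 = thr (dig (Suc N) z) i \<and> reg s1 18 = dig (Suc N) z i"
      using s unfolding s1_def fetch_def
      by (cases "thr (dig (Suc N) z) i < dig (Suc N) z i") (simp_all add: globals_def gain_def)
    have "?R2 (exec (update_thr i) s1)"
    proof (cases "i = 1")
      case True
      then have "reg s1 14 = dig (Suc N) z 0" "reg s1 18 = dig (Suc N) z 1"
        using s1 by (auto simp: thr_def)
      then show ?thesis using s1 True
        by (cases "dig (Suc N) z 0 = 0"; cases "dig (Suc N) z 1 = 0")
          (auto simp: update_thr_def globals_def thr_def)
    next
      case False
      then show ?thesis using s1 by (auto simp: update_thr_def globals_def thr_def)
    qed
    then show "?R2 (exec (seqs [fetch, update_thr i]) s)" by (simp add: s1_def)
  qed (auto simp: fetch_def update_thr_def)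
  have 3: "hoare ?R2 scale (6 * Suc N + 20) (cell_inv Q N a k z m (Suc i))"
    by (rule hoare_scale) (auto simp: cell_inv_def globals_def power_Suc2)
  show ?thesis
    unfolding cell_step_def
    by (rule hoare_weaken[OF hoare_seqs_Cons[OF 1 hoare_seqs_Cons[OF 2 hoare_seqs_Cons[OF 3 hoare_seqs_Nil]]]]) auto
qed

text \<open>The number \<open>k\<close> counts the cells left. Layers for the lengths 0 to
  \<open>N\<close> end at \<open>(N + 2) * Suc N ^ (Q + 2)\<close>; the one for length 0 is ready at
  the start, so \<open>N\<close> layers remain.\<close>

definition main_inv :: "nat \<Rightarrow> nat \<Rightarrow> nat \<Rightarrow> nat \<Rightarrow> state \<Rightarrow> bool" where
  "main_inv Q N a k s \<longleftrightarrow> globals Q N a s \<and> reg s 10 = k \<and> k \<le> N * Suc N ^ (Q + 2) \<and>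
     reg s 9 = (N + 2) * Suc N ^ (Q + 2) - k \<and> table_correct Q (Suc N) (mem s) (reg s 9)"

lemma hoare_fill_cell:
  assumes "0 < N" "0 < Q" "k < N * Suc N ^ (Q + 2)"
  shows "hoare (main_inv Q N a (Suc k)) (fill_cell Q)
    ((Q + 2) * (8 * ((N + 2) * Suc N ^ (Q + 2)) + 6 * N + 101) + 30) (main_inv Q N a k)"
proof (rule hoare_ghost)
  fix s0 assume s0: "main_inv Q N a (Suc k) s0"
  let ?S = "Suc N ^ (Q + 2)"
  define z :: nat where "z = (N + 2) * ?S - Suc k"
  define m where "m = mem s0"
  have z: "z \<le> (N + 2) * ?S" "2 * ?S \<le> z" "Suc z = (N + 2) * ?S - k"
    using assms(3) unfolding z_def add_mult_distrib by linarith+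
  have 1: "hoare (\<lambda>s. s = s0) (seqs [Add 11 9 15, Sub 13 13 13, Sub 14 14 14, Const 4 1]) 10
      (cell_inv Q N a (Suc k) z m 0)"
    by (rule hoare_straight)
      (use s0 in \<open>auto simp: main_inv_def cell_inv_def globals_def z_def m_def thr_def\<close>)
  have 2: "hoare (cell_inv Q N a (Suc k) z m 0) (seqs (map cell_step [0..<Q + 2]))
      ((Q + 2) * Suc (8 * z + 6 * N + 100)) (cell_inv Q N a (Suc k) z m (Q + 2))"
    by (rule hoare_seqs_map) (rule hoare_cell_step)
  have 3: "hoare (cell_inv Q N a (Suc k) z m (Q + 2)) (seqs [Store 9 13, Add 9 9 2, Sub 10 10 2]) 10
      (main_inv Q N a k)"
  proof (rule hoare_straight)
    fix s assume s: "cell_inv Q N a (Suc k) z m (Q + 2) s"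
    have "reg s0 9 = z" "table_correct Q (Suc N) m (reg s0 9)"
      using s0 unfolding main_inv_def z_def m_def by blast+
    then have "table_correct Q (Suc N) (m(z := \<Sum>i<Q + 2. gain Q (Suc N) m z i)) (Suc z)"
      using z(2) assms(1,2) by (intro table_correct_Suc) auto
    then show "main_inv Q N a k (exec (seqs [Store 9 13, Add 9 9 2, Sub 10 10 2]) s)"
      using s assms(3) unfolding cell_inv_def main_inv_def globals_def z(3)[symmetric] by simp
  qed auto
  have "(Q + 2) * Suc (8 * z + 6 * N + 100) \<le> (Q + 2) * (8 * ((N + 2) * ?S) + 6 * N + 101)"
    using z(1) by (intro mult_le_mono2) linarith
  then show "hoare (\<lambda>s. s = s0) (fill_cell Q)
      ((Q + 2) * (8 * ((N + 2) * ?S) + 6 * N + 101) + 30) (main_inv Q N a k)"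
    unfolding fill_cell_def
    by (intro hoare_weaken[OF hoare_seqs_Cons[OF 1 hoare_seqs_Cons[OF 2 hoare_seqs_Cons[OF 3 hoare_seqs_Nil]]]]) linarith+
qed

lemma hoare_fill_table:
  assumes "0 < N" "0 < Q"
  shows "hoare (main_inv Q N a (N * Suc N ^ (Q + 2))) (While 10 (fill_cell Q))
    (N * Suc N ^ (Q + 2) * ((Q + 2) * (8 * ((N + 2) * Suc N ^ (Q + 2)) + 6 * N + 101) + 30 + 2) + 1)
    (main_inv Q N a 0)"
  by (rule hoare_While[where I = "main_inv Q N a", OF hoare_fill_cell[OF assms]]) (auto simp: main_inv_def)

section \<open>Reading the input and preparing the table\<close>

definition load_coord :: "nat \<Rightarrow> nat \<Rightarrow> com" where
  "load_coord Q i =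
    (if i = 0 then seqs [seqs [Const 19 Q, Sub 6 6 6, Load 7 19, Sub 7 7 2],
       While 7 (seqs [Add 6 6 2, Add 19 19 2, Load 7 19, Sub 7 7 2])]
     else if i = 1 then seqs [Const 19 Q, Sub 6 1 19]
     else seqs [Const 19 (Q + 1 - i), Load 6 19])"

definition coord_step :: "nat \<Rightarrow> nat \<Rightarrow> com" where
  "coord_step Q i = seqs [load_coord Q i, mul_add 5 4 6, scale]"

text \<open>After the coordinates, register 4 has grown to the layer size. Adding
  \<open>N + 1\<close> layers to the packed coordinates gives the address of the result. Memory is
  written only once the input has been read.\<close>

definition prepare :: "nat \<Rightarrow> com" where
  "prepare Q = seqs [seqs [Const 2 1, Add 3 0 2, Const 4 1],
     seqs (map (coord_step Q) [0..<Q + 2]),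
     seqs [Add 8 4 15, Add 6 3 15], mul_add 5 8 6,
     seqs [Store 8 2, Add 9 8 8, Add 6 0 15], mul_add 10 8 6]"

definition program :: "nat \<Rightarrow> com" where
  "program Q = seqs [prepare Q, While 10 (fill_cell Q), seqs [Load 0 5, Const 1 1]]"

definition coord_inv :: "nat \<Rightarrow> nat \<Rightarrow> nat list \<Rightarrow> nat \<Rightarrow> state \<Rightarrow> bool" where
  "coord_inv Q N l i s \<longleftrightarrow> reg s 0 = N \<and> reg s 1 = length l \<and> reg s 2 = 1 \<and> reg s 3 = Suc N \<and>
     reg s 4 = Suc N ^ i \<and> reg s 5 = (\<Sum>j<i. profile l Q j * Suc N ^ j) \<and> reg s 10 = 0 \<and> reg s 15 = 0 \<and>
     mem s = (\<lambda>a. if a < length l then l ! a else 0)"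

lemma hoare_load_coord:
  "hoare (coord_inv Q N l i) (load_coord Q i) (10 * profile l Q i + 20)
    (\<lambda>s. coord_inv Q N l i s \<and> reg s 6 = profile l Q i)"
proof -
  consider "i = 0" | "i = 1" | "2 \<le> i" by linarith
  then show ?thesis
  proof cases
    case 1
    let ?part = "\<lambda>a. if a < length l then l ! a else 0"
    let ?p = "profile l Q 0"
    have p: "?p = (LEAST j. ?part (Q + j) \<le> 1)" by (simp add: profile_def)
    \<comment> \<open>The zeros behind the input stop the scan for the first part that is at most
      1.\<close>
    have "?part (Q + length l) \<le> 1" by simp
    then have stop: "?part (Q + ?p) \<le> 1" unfolding p by (rule LeastI)
    have before: "1 < ?part (Q + j)" if "j < ?p" for j
      using not_less_Least[of j "\<lambda>j. ?part (Q + j) \<le> 1"] that unfolding p by linarith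
    define I where "I k s \<longleftrightarrow> coord_inv Q N l 0 s \<and> reg s 6 + k = ?p \<and> reg s 19 = Q + reg s 6 \<and>
      reg s 7 = ?part (Q + reg s 6) - 1" for k and s :: state
    have init: "hoare (coord_inv Q N l 0) (seqs [Const 19 Q, Sub 6 6 6, Load 7 19, Sub 7 7 2]) 10 (I ?p)"
      by (rule hoare_straight) (auto simp: I_def coord_inv_def)
    have loop: "hoare (I ?p) (While 7 (seqs [Add 6 6 2, Add 19 19 2, Load 7 19, Sub 7 7 2])) (?p * (8 + 2) + 1) (I 0)"
    proof (rule hoare_While)
      fix k
      show "hoare (I (Suc k)) (seqs [Add 6 6 2, Add 19 19 2, Load 7 19, Sub 7 7 2]) 8 (I k)"
        by (rule hoare_straight) (auto simp: I_def coord_inv_def)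
    next
      fix k s assume I: "I k s"
      show "reg s 7 \<noteq> 0 \<longleftrightarrow> k \<noteq> 0"
      proof (cases "k = 0")
        case True
        then have "reg s 6 = ?p" using I by (simp add: I_def)
        then show ?thesis using True I stop by (simp add: I_def split: if_splits)
      next
        case False
        then have "reg s 6 < ?p" using I by (simp add: I_def)
        then show ?thesis using False I before[of "reg s 6"] by (simp add: I_def)
      qed
    qed
    have load: "load_coord Q 0 = seqs [seqs [Const 19 Q, Sub 6 6 6, Load 7 19, Sub 7 7 2],
        While 7 (seqs [Add 6 6 2, Add 19 19 2, Load 7 19, Sub 7 7 2])]"
      by (simp add: load_coord_def)
    show ?thesis
      unfolding 1 load
      by (rule hoare_weaken[OF hoare_seqs_Cons[OF init hoare_seqs_Cons[OF loop hoare_seqs_Nil]]])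
        (auto simp: I_def)
  next
    case 2
    then show ?thesis
      by (intro hoare_straight) (auto simp: load_coord_def coord_inv_def profile_def Let_def)
  next
    case 3
    then show ?thesis
      by (intro hoare_straight) (auto simp: load_coord_def coord_inv_def profile_def Let_def)
  qed
qed

lemma hoare_coord_step:
  assumes "profile l Q i \<le> N"
  shows "hoare (coord_inv Q N l i) (coord_step Q i) (30 * N + 100) (coord_inv Q N l (Suc i))"
proof -
  let ?R = "\<lambda>s. reg s 0 = N \<and> reg s 1 = length l \<and> reg s 2 = 1 \<and> reg s 3 = Suc N \<and>
     reg s 4 = Suc N ^ i \<and> reg s 5 = (\<Sum>j<Suc i. profile l Q j * Suc N ^ j) \<and> reg s 10 = 0 \<and> reg s 15 = 0 \<and>
     mem s = (\<lambda>a. if a < length l then l ! a else 0)"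
  have 2: "hoare (\<lambda>s. coord_inv Q N l i s \<and> reg s 6 = profile l Q i) (mul_add 5 4 6) (6 * N + 1) ?R"
    by (rule hoare_mul_add[where n = N]) (use assms in \<open>auto simp: coord_inv_def\<close>)
  have 3: "hoare ?R scale (6 * Suc N + 20) (coord_inv Q N l (Suc i))"
    by (rule hoare_scale) (auto simp: coord_inv_def power_Suc2)
  show ?thesis
    unfolding coord_step_def
    by (rule hoare_weaken[OF hoare_seqs_Cons[OF hoare_load_coord
          hoare_seqs_Cons[OF 2 hoare_seqs_Cons[OF 3 hoare_seqs_Nil]]]])
      (use assms in auto)
qed

definition target :: "nat \<Rightarrow> nat \<Rightarrow> nat list \<Rightarrow> nat" where
  "target Q N l = (N + 1) * Suc N ^ (Q + 2) + (\<Sum>i<Q + 2. profile l Q i * Suc N ^ i)"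

lemma hoare_prepare:
  assumes profile: "\<And>i. i < Q + 2 \<Longrightarrow> profile l Q i \<le> N" and "length l \<le> N" "0 < N"
  shows "hoare (\<lambda>s. s = init l N \<epsilon> \<delta>) (prepare Q) ((Q + 2) * (30 * N + 101) + 12 * N + 100)
    (main_inv Q N (target Q N l) (N * Suc N ^ (Q + 2)))"
proof -
  let ?S = "Suc N ^ (Q + 2)" let ?t = "target Q N l"
  let ?m = "\<lambda>a. if a < length l then l ! a else 0"
  \<comment> \<open>The input occupies at most \<open>N\<close> cells, so the table area, starting
    at \<open>?S\<close>, is still zero.\<close>
  have S: "Suc N \<le> ?S" by (rule self_le_power) auto
  let ?R3 = "\<lambda>s. reg s 0 = N \<and> reg s 2 = 1 \<and> reg s 3 = Suc N \<and> reg s 8 = ?S \<and> reg s 6 = Suc N \<and>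
     reg s 5 = (\<Sum>j<Q + 2. profile l Q j * Suc N ^ j) \<and> reg s 10 = 0 \<and> reg s 15 = 0 \<and> mem s = ?m"
  let ?R4 = "\<lambda>s. globals Q N ?t s \<and> reg s 10 = 0 \<and> mem s = ?m"
  let ?R5 = "\<lambda>s. globals Q N ?t s \<and> reg s 6 = N \<and> reg s 9 = 2 * ?S \<and> reg s 10 = 0 \<and> mem s = ?m(?S := 1)"
  have 1: "hoare (\<lambda>s. s = init l N \<epsilon> \<delta>) (seqs [Const 2 1, Add 3 0 2, Const 4 1]) 10 (coord_inv Q N l 0)"
    by (rule hoare_straight) (auto simp: coord_inv_def init_def)
  have 2: "hoare (coord_inv Q N l 0) (seqs (map (coord_step Q) [0..<Q + 2]))
      ((Q + 2) * Suc (30 * N + 100)) (coord_inv Q N l (Q + 2))"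
    by (rule hoare_seqs_map) (rule hoare_coord_step[OF profile])
  have 3: "hoare (coord_inv Q N l (Q + 2)) (seqs [Add 8 4 15, Add 6 3 15]) 10 ?R3"
    by (rule hoare_straight) (auto simp: coord_inv_def)
  have 4: "hoare ?R3 (mul_add 5 8 6) (6 * Suc N + 1) ?R4"
    by (rule hoare_mul_add[where n = "Suc N"]) (auto simp: globals_def target_def)
  have 5: "hoare ?R4 (seqs [Store 8 2, Add 9 8 8, Add 6 0 15]) 10 ?R5"
    by (rule hoare_straight) (auto simp: globals_def)
  have 6: "hoare ?R5 (mul_add 10 8 6) (6 * N + 1) (main_inv Q N ?t (N * ?S))"
  proof (rule hoare_mul_add[where n = N])
    fix s assume s: "?R5 s"
    have "table_correct Q (Suc N) (?m(?S := 1)) (2 * ?S)"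
      using S assms(2,3) by (intro table_correct_initial) auto
    moreover have "(N + 2) * ?S - N * ?S = 2 * ?S" by (simp add: diff_mult_distrib[symmetric] del: power_Suc)
    ultimately show "main_inv Q N ?t (N * ?S) (set_reg 6 0 (set_reg 10 (reg s 10 + reg s 8 * reg s 6) s))"
      using s by (simp add: main_inv_def globals_def mult.commute[of N])
  qed (auto simp: globals_def)
  show ?thesis
    unfolding prepare_def
    by (rule hoare_weaken[OF hoare_seqs_Cons[OF 1 hoare_seqs_Cons[OF 2 hoare_seqs_Cons[OF 3
          hoare_seqs_Cons[OF 4 hoare_seqs_Cons[OF 5 hoare_seqs_Cons[OF 6 hoare_seqs_Nil]]]]]]])
      (auto simp: add_mult_distrib2)
qed

lemma hoare_program:
  assumes profile: "\<And>i. i < Q + 2 \<Longrightarrow> profile l Q i \<le> N" and "length l \<le> N" "0 < N" "0 < Q"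
    and valid: "valid Q (profile l Q)"
  shows "hoare (\<lambda>s. s = init l N \<epsilon> \<delta>) (program Q)
    ((Q + 2) * (30 * N + 101) + 12 * N + 100 +
      N * Suc N ^ (Q + 2) * ((Q + 2) * (8 * ((N + 2) * Suc N ^ (Q + 2)) + 6 * N + 101) + 32) + 20)
    (\<lambda>s. reg s 0 = walks Q N (profile l Q) \<and> reg s 1 = 1)"
proof -
  have 3: "hoare (main_inv Q N (target Q N l) 0) (seqs [Load 0 5, Const 1 1]) 10
      (\<lambda>s. reg s 0 = walks Q N (profile l Q) \<and> reg s 1 = 1)"
  proof (rule hoare_straight)
    fix s assume s: "main_inv Q N (target Q N l) 0 s"
    have "mem s (target Q N l) = walks Q N (profile l Q)"
      unfolding target_def
    proof (rule table_correct_final[OF _ valid])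
      show "table_correct Q (Suc N) (mem s) ((N + 2) * Suc N ^ (Q + 2))"
        using s unfolding main_inv_def diff_zero by metis
      show "\<And>i. i < Q + 2 \<Longrightarrow> profile l Q i < Suc N"
        using profile by (simp add: less_Suc_eq_le)
    qed
    then show "reg (exec (seqs [Load 0 5, Const 1 1]) s) 0 = walks Q N (profile l Q) \<and>
        reg (exec (seqs [Load 0 5, Const 1 1]) s) 1 = 1"
      using s by (simp add: main_inv_def globals_def)
  qed auto
  show ?thesis
    unfolding program_def
    by (rule hoare_weaken[OF hoare_seqs_Cons[OF hoare_prepare[OF assms(1-3)]
          hoare_seqs_Cons[OF hoare_fill_table[OF assms(3,4)] hoare_seqs_Cons[OF 3 hoare_seqs_Nil]]]])
      (auto simp del: power_Suc)
qed

section \<open>Polynomial running time\<close>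

lemma program_time_bound:
  fixes N Q :: nat
  assumes "0 < N"
  shows "(Q + 2) * (30 * N + 101) + 12 * N + 100 +
      N * Suc N ^ (Q + 2) * ((Q + 2) * (8 * ((N + 2) * Suc N ^ (Q + 2)) + 6 * N + 101) + 32) + 20
    \<le> 1000 * (Q + 2) * 2 ^ (2 * Q + 6) * N ^ (2 * Q + 6)"
proof -
  define K where "K = Q + 2"
  define S where "S = Suc N ^ K"
  define B where "B = Suc N"
  have B: "2 \<le> B" using assms by (simp add: B_def)
  have S: "1 \<le> S" by (simp add: S_def)
  have K: "1 \<le> K" by (simp add: K_def)
  \<comment> \<open>Everything is compared with \<open>B * S = B ^ (Q + 3)\<close>, which bounds the
    number of cells and, up to a constant factor, the addresses. The main loop costs about their
    product, whence the exponent \<open>2 * Q + 6\<close>.\<close>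
  have lin: "c * N + d \<le> (c + d) * (B * S)" for c d
  proof -
    have "B * 1 \<le> B * S" using S by (rule mult_le_mono2)
    moreover have "N \<le> B" by (simp add: B_def)
    ultimately have "N \<le> B * S" "1 \<le> B * S" using B by linarith+
    then have "c * N + d * 1 \<le> c * (B * S) + d * (B * S)" by (intro add_mono mult_le_mono2)
    then show ?thesis by (simp add: add_mult_distrib)
  qed
  have BS: "1 \<le> B * S" using lin[of 0 1] by simp
  have inner: "8 * ((N + 2) * S) + 6 * N + 101 \<le> 123 * (B * S)"
  proof -
    have "8 * ((N + 2) * S) \<le> 8 * ((2 * B) * S)" by (intro mult_le_mono) (auto simp: B_def)
    then have "8 * ((N + 2) * S) \<le> 16 * (B * S)" by simp
    then show ?thesis using lin[of 6 101] by simp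
  qed
  have "N * S * (K * (8 * ((N + 2) * S) + 6 * N + 101) + 32) \<le> (B * S) * (K * (123 * (B * S)) + 32 * (K * (B * S)))"
    using inner K BS by (intro mult_le_mono add_mono mult_le_mono2) (auto simp: B_def)
  also have "\<dots> = 155 * K * (B * S) ^ 2" by (simp add: power2_eq_square algebra_simps)
  finally have 1: "N * S * (K * (8 * ((N + 2) * S) + 6 * N + 101) + 32) \<le> 155 * K * (B * S) ^ 2" .
  have sq: "B * S \<le> (B * S) ^ 2" using BS by (simp add: power2_eq_square)
  have "K * (30 * N + 101) \<le> K * (131 * (B * S) ^ 2)"
    using lin[of 30 101] sq by (intro mult_le_mono2) simp
  then have 2: "K * (30 * N + 101) \<le> 131 * (K * (B * S) ^ 2)" by simp
  have "12 * N + 120 \<le> 132 * (1 * (B * S) ^ 2)" using lin[of 12 120] sq by simp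
  also have "\<dots> \<le> 132 * (K * (B * S) ^ 2)" using K by (intro mult_le_mono) auto
  finally have 3: "12 * N + 120 \<le> 132 * (K * (B * S) ^ 2)" .
  have "K * (30 * N + 101) + 12 * N + 100 +
      N * S * (K * (8 * ((N + 2) * S) + 6 * N + 101) + 32) + 20 \<le> 1000 * (K * (B * S) ^ 2)"
    using 1 2 3 by linarith
  also have "(B * S) ^ 2 = B ^ (2 * Q + 6)"
  proof -
    have "B * S = B ^ Suc (Q + 2)" unfolding S_def K_def B_def by (simp only: power_Suc)
    moreover have "Suc (Q + 2) * 2 = 2 * Q + 6" by simp
    ultimately show ?thesis by (metis power_mult)
  qed
  \<comment> \<open>The power of 2 in the bound comes from \<open>N + 1 \<le> 2 * N\<close>.\<close>
  also have "1000 * (K * B ^ (2 * Q + 6)) \<le> 1000 * (K * (2 * N) ^ (2 * Q + 6))"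
    using assms by (intro mult_le_mono2 power_mono) (auto simp: B_def)
  finally show ?thesis unfolding K_def S_def power_mult_distrib by (simp only: mult.assoc)
qed

theorem theorem1p2:
  fixes p q :: nat
  shows "\<exists>P. is_fpras P (instances p q) svt_count"
proof -
  define Q where "Q = q + 2"
  define D where "D = 2 * Q + 6"
  \<comment> \<open>The bound is a single monomial, of degree \<open>D\<close> in
    \<open>N\<close>.\<close>
  define c :: "nat \<Rightarrow> nat \<Rightarrow> nat \<Rightarrow> nat \<Rightarrow> real" where
    "c i j k m = (if i = 0 \<and> j = D \<and> k = 0 \<and> m = 0 then real (1000 * (Q + 2) * 2 ^ D) else 0)" for i j k m
  have poly: "poly4 D c w x y z = real (1000 * (Q + 2) * 2 ^ D) * x ^ D" for w x y z
  proof -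
    let ?C = "real (1000 * (Q + 2) * 2 ^ D) * x ^ D"
    let ?f = "\<lambda>i j k m. c i j k m * w ^ i * x ^ j * y ^ k * z ^ m"
    \<comment> \<open>The sums collapse one index at a time from the inside; nesting the conditions
      puts each sum into the form of a single-point sum.\<close>
    have "(\<Sum>m\<le>D. ?f i j k m) = (\<Sum>m\<le>D. if m = 0 then if i = 0 \<and> j = D \<and> k = 0 then ?C else 0 else 0)" for i j k
      by (intro sum.cong) (auto simp: c_def)
    then have m: "(\<Sum>m\<le>D. ?f i j k m) = (if k = 0 then if i = 0 \<and> j = D then ?C else 0 else 0)" for i j k
      by simp
    have k: "(\<Sum>k\<le>D. \<Sum>m\<le>D. ?f i j k m) = (if j = D then if i = 0 then ?C else 0 else 0)" for i j
      unfolding m by simp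
    have j: "(\<Sum>j\<le>D. \<Sum>k\<le>D. \<Sum>m\<le>D. ?f i j k m) = (if i = 0 then ?C else 0)" for i
      unfolding k by simp
    show ?thesis unfolding poly4_def j by simp
  qed
  have "is_fpras (program Q) (instances p q) svt_count"
    unfolding is_fpras_def
  proof (intro exI[of _ D] exI[of _ c] ballI, clarify)
    fix l N and \<epsilon> \<delta> :: real
    assume inst: "(l, N) \<in> instances p q" and eps: "\<epsilon> \<in> {0<..1}" and delta: "\<delta> \<in> {0<..1}"
    have part: "is_partition l" and N: "0 < N" "boxes l \<le> N"
      using inst by (auto simp: instances_def)
    have shape: "shape Q (profile l Q) = diagram l"
      using shape_profile[OF part] instance_narrow[OF inst] by (simp add: Q_def)
    have valid: "valid Q (profile l Q)"
      using valid_profile[OF part] instance_narrow[OF inst] by (simp add: Q_def)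
    have profile: "profile l Q i \<le> N" if "i < Q + 2" for i
      using profile_le_card_shape[OF that, of "profile l Q"] N(2) unfolding shape boxes_def by simp
    have len: "length l \<le> N" using length_le_boxes[OF part] N by simp
    have "0 < Q" by (simp add: Q_def)
    note triple = hoare_program[OF profile len N(1) this valid]
    have "hoare (\<lambda>s. s = init l N \<epsilon> \<delta>) (program Q) (1000 * (Q + 2) * 2 ^ D * N ^ D)
        (\<lambda>s. reg s 0 = walks Q N (profile l Q) \<and> reg s 1 = 1)"
      unfolding D_def by (rule hoare_weaken[OF triple _ _ program_time_bound[OF N(1)]])
    then obtain t s where t: "t \<le> 1000 * (Q + 2) * 2 ^ D * N ^ D"
      and big: "big (program Q) (init l N \<epsilon> \<delta>) t s"
      and s: "reg s 0 = walks Q N (profile l Q)" "reg s 1 = 1"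
      unfolding hoare_def by blast
    have run: "run t (program Q, init l N \<epsilon> \<delta>) = return_pmf (Skip, s)"
      by (rule big_run[OF big])
    have "reg s 0 = svt_count l N"
      unfolding s(1) walks_def shape svt_count_eq_card_words ..
    then have "outputs (Skip, s) (real (svt_count l N))"
      using s(2) by (simp add: outputs_def halted_def)
    moreover have "(1 - \<epsilon>) * real (svt_count l N) \<le> real (svt_count l N)"
      "real (svt_count l N) \<le> (1 + \<epsilon>) * real (svt_count l N)"
      using eps by (auto simp: algebra_simps)
    ultimately have good: "\<exists>A. outputs (Skip, s) A \<and>
        (1 - \<epsilon>) * real (svt_count l N) \<le> A \<and> A \<le> (1 + \<epsilon>) * real (svt_count l N)" by blast
    show "\<exists>t. real t \<le> poly4 D c (real (boxes l)) (real N) (1 / \<epsilon>) (ln (1 / \<delta>)) \<and>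
        (\<forall>cfg \<in> set_pmf (run t (program Q, init l N \<epsilon> \<delta>)). halted cfg) \<and>
        measure_pmf.prob (run t (program Q, init l N \<epsilon> \<delta>))
          {cfg. \<exists>A. outputs cfg A \<and>
             (1 - \<epsilon>) * real (svt_count l N) \<le> A \<and> A \<le> (1 + \<epsilon>) * real (svt_count l N)} \<ge> 1 - \<delta>"
    proof (intro exI[of _ t] conjI)
      show "real t \<le> poly4 D c (real (boxes l)) (real N) (1 / \<epsilon>) (ln (1 / \<delta>))"
        unfolding poly using t by (metis of_nat_le_iff of_nat_mult of_nat_power)
      show "\<forall>cfg \<in> set_pmf (run t (program Q, init l N \<epsilon> \<delta>)). halted cfg"
        by (simp add: run halted_def)
      \<comment> \<open>The run is a point mass on an exact output, so the probability is 1.\<close>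
      show "measure_pmf.prob (run t (program Q, init l N \<epsilon> \<delta>))
          {cfg. \<exists>A. outputs cfg A \<and>
             (1 - \<epsilon>) * real (svt_count l N) \<le> A \<and> A \<le> (1 + \<epsilon>) * real (svt_count l N)} \<ge> 1 - \<delta>"
        using delta good by (simp add: run measure_return_pmf indicator_def)
    qed
  qed
  then show ?thesis ..
qed

end
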